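(* Suppose $\pi>0$. When $D(t)=D(T)$ for all $t\in[0,T]$, the optimal value of P$^{\mathrm{ave}}_{\text{return}}$ can be computed in constant time and an optimal solution of P$^{\mathrm{ave}}_{\text{return}}$ can be computed in time $O(S)$.
   Context: Data: a positive integer $S$ (number of shuttles), a capacity $C>0$, a period length $T$, a loading rate $\nu\geq 0$, a return time $\pi\geq 0$, and a nondecreasing upper semicontinuous function $D:[0,T]\to\mathbb{R}_+$ with $D(T)>0$ (cumulative demand). Pseudo-inverses of $D$: for $y\in[0,D(T)]$, $\tau(y)=\inf\{t\in[0,T]: D(t)>y\}$ if $y<D(T)$ and $\tau(D(T))=T$; $\bar\tau(y)=\inf\{t\in[0,T]: D(t)\geq y\}$. Problem P$^{\mathrm{ave}}_{\text{return}}$: over sequences of nonnegative reals $\boldsymbol d=(d_j)_{j\geq 1}$, $\boldsymbol y=(y_j)_{j\geq 1}$, with $y_0=0$, minimize $$g^{\mathrm{ave}}(\boldsymbol d,\boldsymbol y)=\frac{1}{D(T)}\sum_{j\geq 1}\int_{y_{j-1}}^{y_j}\big(d_j-\bar\tau(y)\big)\,dy$$ subject to: (i) $y_j-y_{j-1}\leq C$ for $j\geq 1$; (ii) $y_{j-1}\leq y_j$ for $j\geq 1$; (iii) $d_{j-1}\leq d_j$ for $j\geq 2$; (iv) $\lim_{j\to+\infty}y_j=D(T)$; (v) $\bar\tau(y_j)+\nu(y_j-y_{j-1})\leq d_j$ for $j\geq 1$; (vi) $d_j+\pi+\nu(y_{j+S}-y_{j+S-1})\leq d_{j+S}$ for $j\geq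 1$. Computational model: the following operations take constant time: evaluation of $D(t)$ for any $t\in[0,T]$; integration of $D$ between two values; evaluation of $\tau(y)$ and $\bar\tau(y)$ for any $y$; evaluation of $\sup\{y:\bar\tau(y)+\nu y\leq\alpha\}$ for any $\alpha\in\mathbb{R}_+$. The quantities $C$, $T$, $D(\cdot)$, $\nu$, $\pi$ are constants of the computational model (the constants in the complexity bounds may depend on them, but not on $S$). *)

theory Defs
  imports "HOL-Analysis.Analysis"
begin

record shuttle_data =
  capacity :: real                 (* C *)
  period :: real                   (* T *)
  load_rate :: real                (* nu *)
  return_time :: real              (* pi *)
  demand :: "real \<Rightarrow> real"         (* D, only meaningful on {0..T} *)

definition total_demand :: "shuttle_data \<Rightarrow> real" where
  "total_demand I = demand I (period I)"

definition upper_semicontinuous_on :: "'a::topological_space set \<Rightarrow> ('a \<Rightarrow> real) \<Rightarrow> bool" where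
  "upper_semicontinuous_on A f \<longleftrightarrow>
     (\<forall>x\<in>A. \<forall>a>f x. eventually (\<lambda>z. f z < a) (at x within A))"

definition valid_data :: "shuttle_data \<Rightarrow> bool" where
  "valid_data I \<longleftrightarrow>
     capacity I > 0 \<and> period I \<ge> 0 \<and> load_rate I \<ge> 0 \<and> return_time I \<ge> 0 \<and>
     mono_on {0..period I} (demand I) \<and>
     upper_semicontinuous_on {0..period I} (demand I) \<and>
     (\<forall>t\<in>{0..period I}. demand I t \<ge> 0) \<and>
     total_demand I > 0"


section \<open>The optimization problem\<close>

definition tau :: "shuttle_data \<Rightarrow> real \<Rightarrow> real" where
  "tau I y = (if y < total_demand I then Inf {t \<in> {0..period I}. demand I t > y} else period I)"

definition taubar :: "shuttle_data \<Rightarrow> real \<Rightarrow> real" where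
  "taubar I y = Inf {t \<in> {0..period I}. demand I t \<ge> y}"

text \<open>The value \<open>d 0\<close> is never used. The constraints force \<open>0 \<le> y j \<le> D(T)\<close> for all \<open>j\<close>, so
  \<open>taubar\<close> is only applied where the set in its definition is nonempty.\<close>

definition feasible :: "shuttle_data \<Rightarrow> nat \<Rightarrow> (nat \<Rightarrow> real) \<Rightarrow> (nat \<Rightarrow> real) \<Rightarrow> bool" where
  "feasible I S d y \<longleftrightarrow>
     (\<forall>j\<ge>1. d j \<ge> 0) \<and> (\<forall>j\<ge>1. y j \<ge> 0) \<and> y 0 = 0 \<and>
     (\<forall>j\<ge>1. y j - y (j - 1) \<le> capacity I) \<and>
     (\<forall>j\<ge>1. y (j - 1) \<le> y j) \<and>
     (\<forall>j\<ge>2. d (j - 1) \<le> d j) \<and>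
     y \<longlonglongrightarrow> total_demand I \<and>
     (\<forall>j\<ge>1. taubar I (y j) + load_rate I * (y j - y (j - 1)) \<le> d j) \<and>
     (\<forall>j\<ge>1. d j + return_time I + load_rate I * (y (j + S) - y (j + S - 1)) \<le> d (j + S))"

text \<open>On feasible pairs every summand is nonnegative (and \<open>taubar\<close> is monotone, hence integrable),
  so the series has a well-defined value in \<open>[0, \<infinity>]\<close>. The summation index is shifted by one.\<close>

definition g_ave :: "shuttle_data \<Rightarrow> (nat \<Rightarrow> real) \<Rightarrow> (nat \<Rightarrow> real) \<Rightarrow> ereal" where
  "g_ave I d y = ereal (1 / total_demand I) *
     (\<Sum>j. ereal (integral {y j..y (Suc j)} (\<lambda>u. d (Suc j) - taubar I u)))"

definition optimal_value :: "shuttle_data \<Rightarrow> nat \<Rightarrow> ereal" where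
  "optimal_value I S = Inf {g_ave I d y | d y. feasible I S d y}"

definition optimal_solution :: "shuttle_data \<Rightarrow> nat \<Rightarrow> (nat \<Rightarrow> real) \<Rightarrow> (nat \<Rightarrow> real) \<Rightarrow> bool" where
  "optimal_solution I S d y \<longleftrightarrow>
     feasible I S d y \<and> (\<forall>d' y'. feasible I S d' y' \<longrightarrow> g_ave I d y \<le> g_ave I d' y')"


section \<open>The computational model\<close>

text \<open>A random access machine over the reals: while programs on a memory of real-valued cells with
  indirect addressing and an append-only output. Apart from field arithmetic and comparisons, the
  programs may use \<open>C\<close>, \<open>T\<close>, \<open>\<nu>\<close>, \<open>\<pi>\<close> and the five oracle operations on \<open>D\<close>. The syntax does not
  depend on the data: only integer constants occur in a program text. An operation applied outside
  its domain makes the program stuck.\<close>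

datatype param = Capacity | Period | Load_Rate | Return_Time

datatype unop = Eval_D | Eval_Tau | Eval_Taubar | Sup_Load

datatype binop = Add | Sub | Mult | Div | Integral_D

datatype expr =
    Num int
  | Param param
  | Cell expr
  | Unary unop expr
  | Binary binop expr expr

datatype test = Less expr expr | Less_Eq expr expr

datatype prog =
    Skip
  | Store expr expr                (* address, value *)
  | Emit expr
  | Seq prog prog
  | Cond test prog prog
  | While test prog

primrec param_val :: "shuttle_data \<Rightarrow> param \<Rightarrow> real" where
  "param_val I Capacity = capacity I"
| "param_val I Period = period I"
| "param_val I Load_Rate = load_rate I"
| "param_val I Return_Time = return_time I"

primrec unop_val :: "shuttle_data \<Rightarrow> unop \<Rightarrow> real \<Rightarrow> real option" where
  "unop_val I Eval_D x =
     (if x \<in> {0..period I} then Some (demand I x) else None)"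
| "unop_val I Eval_Tau x =
     (if x \<in> {0..total_demand I} then Some (tau I x) else None)"
| "unop_val I Eval_Taubar x =
     (if x \<in> {0..total_demand I} then Some (taubar I x) else None)"
| "unop_val I Sup_Load x =
     (if x \<ge> 0
      then Some (Sup {y \<in> {0..total_demand I}. taubar I y + load_rate I * y \<le> x}) else None)"

primrec binop_val :: "shuttle_data \<Rightarrow> binop \<Rightarrow> real \<Rightarrow> real \<Rightarrow> real option" where
  "binop_val I Add x z = Some (x + z)"
| "binop_val I Sub x z = Some (x - z)"
| "binop_val I Mult x z = Some (x * z)"
| "binop_val I Div x z = (if z \<noteq> 0 then Some (x / z) else None)"
| "binop_val I Integral_D x z =
     (if 0 \<le> x \<and> x \<le> z \<and> z \<le> period I then Some (integral {x..z} (demand I)) else None)"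

definition address :: "real \<Rightarrow> nat option" where
  "address x = (if x \<in> \<nat> then Some (nat \<lfloor>x\<rfloor>) else None)"

primrec eval_expr :: "shuttle_data \<Rightarrow> (nat \<Rightarrow> real) \<Rightarrow> expr \<Rightarrow> real option" where
  "eval_expr I m (Num k) = Some (of_int k)"
| "eval_expr I m (Param p) = Some (param_val I p)"
| "eval_expr I m (Cell e) =
     Option.bind (eval_expr I m e) (\<lambda>x. map_option m (address x))"
| "eval_expr I m (Unary f e) = Option.bind (eval_expr I m e) (unop_val I f)"
| "eval_expr I m (Binary f e1 e2) =
     Option.bind (eval_expr I m e1) (\<lambda>x. Option.bind (eval_expr I m e2) (binop_val I f x))"

primrec eval_test :: "shuttle_data \<Rightarrow> (nat \<Rightarrow> real) \<Rightarrow> test \<Rightarrow> bool option" where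
  "eval_test I m (Less e1 e2) =
     Option.bind (eval_expr I m e1) (\<lambda>x. map_option (\<lambda>z. x < z) (eval_expr I m e2))"
| "eval_test I m (Less_Eq e1 e2) =
     Option.bind (eval_expr I m e1) (\<lambda>x. map_option (\<lambda>z. x \<le> z) (eval_expr I m e2))"

text \<open>Each node of an evaluated expression counts as one unit of time, as does each executed
  command and each comparison.\<close>

primrec expr_cost :: "expr \<Rightarrow> nat" where
  "expr_cost (Num k) = 1"
| "expr_cost (Param p) = 1"
| "expr_cost (Cell e) = expr_cost e + 1"
| "expr_cost (Unary f e) = expr_cost e + 1"
| "expr_cost (Binary f e1 e2) = expr_cost e1 + expr_cost e2 + 1"

primrec test_cost :: "test \<Rightarrow> nat" where
  "test_cost (Less e1 e2) = expr_cost e1 + expr_cost e2 + 1"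
| "test_cost (Less_Eq e1 e2) = expr_cost e1 + expr_cost e2 + 1"

type_synonym state = "(nat \<Rightarrow> real) \<times> real list"

text \<open>\<open>exec I P s n s'\<close>: started in state \<open>s\<close>, the program \<open>P\<close> halts in state \<open>s'\<close> after \<open>n\<close> units
  of time.\<close>

inductive exec :: "shuttle_data \<Rightarrow> prog \<Rightarrow> state \<Rightarrow> nat \<Rightarrow> state \<Rightarrow> bool" for I where
  Skip: "exec I Skip s 1 s"
| Store: "eval_expr I m e1 = Some x \<Longrightarrow> address x = Some a \<Longrightarrow> eval_expr I m e2 = Some v \<Longrightarrow>
     exec I (Store e1 e2) (m, out) (expr_cost e1 + expr_cost e2 + 1) (m(a := v), out)"
| Emit: "eval_expr I m e = Some v \<Longrightarrow>
     exec I (Emit e) (m, out) (expr_cost e + 1) (m, out @ [v])"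
| Seq: "exec I P s n s' \<Longrightarrow> exec I Q s' n' s'' \<Longrightarrow> exec I (Seq P Q) s (n + n' + 1) s''"
| Cond_True: "eval_test I (fst s) b = Some True \<Longrightarrow> exec I P s n s' \<Longrightarrow>
     exec I (Cond b P Q) s (test_cost b + n + 1) s'"
| Cond_False: "eval_test I (fst s) b = Some False \<Longrightarrow> exec I Q s n s' \<Longrightarrow>
     exec I (Cond b P Q) s (test_cost b + n + 1) s'"
| While_False: "eval_test I (fst s) b = Some False \<Longrightarrow>
     exec I (While b P) s (test_cost b + 1) s"
| While_True: "eval_test I (fst s) b = Some True \<Longrightarrow> exec I P s n s' \<Longrightarrow>
     exec I (While b P) s' n' s'' \<Longrightarrow>
     exec I (While b P) s (test_cost b + n + n' + 1) s''"

text \<open>The input \<open>S\<close> is placed in cell 0; all other cells contain 0 and the output is empty.\<close>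

definition outputs_within ::
  "shuttle_data \<Rightarrow> prog \<Rightarrow> nat \<Rightarrow> real list \<Rightarrow> nat \<Rightarrow> bool" where
  "outputs_within I P S out N \<longleftrightarrow>
     (\<exists>n m. exec I P ((\<lambda>_. 0)(0 := real S), []) n (m, out) \<and> n \<le> N)"

text \<open>A solution is an infinite object, so it has to be output in finite form. The list
  \<open>[d 1, y 1, \<dots>, d n, y n]\<close> with \<open>n \<ge> 1\<close> stands for the pair of sequences starting with these
  values and continued after index \<open>n\<close> by empty departures at intervals of \<open>\<pi>\<close>.\<close>

definition decode_d :: "shuttle_data \<Rightarrow> real list \<Rightarrow> nat \<Rightarrow> real" where
  "decode_d I out j = (let n = length out div 2 in
     if j \<le> n then out ! (2 * (j - 1))
     else out ! (2 * (n - 1)) + real (j - n) * return_time I)"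

definition decode_y :: "real list \<Rightarrow> nat \<Rightarrow> real" where
  "decode_y out j = (let n = length out div 2 in
     if j = 0 then 0 else out ! (2 * (min j n - 1) + 1))"

definition computes_optimal_value_within :: "prog \<Rightarrow> shuttle_data \<Rightarrow> nat \<Rightarrow> nat \<Rightarrow> bool" where
  "computes_optimal_value_within P I S N \<longleftrightarrow>
     (\<exists>v. outputs_within I P S [v] N \<and> ereal v = optimal_value I S)"

definition computes_optimal_solution_within :: "prog \<Rightarrow> shuttle_data \<Rightarrow> nat \<Rightarrow> nat \<Rightarrow> bool" where
  "computes_optimal_solution_within P I S N \<longleftrightarrow>
     (\<exists>out. outputs_within I P S out N \<and> out \<noteq> [] \<and> even (length out) \<and>
        optimal_solution I S (decode_d I out) (decode_y out))"

end

theory Submission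
  imports Defs
begin

text \<open>
  With constant demand \<open>W = D(T)\<close> all passengers are present from time 0, so \<open>taubar\<close> vanishes on the
  relevant range and the problem is to minimise \<open>\<Sum> d j (y j - y (j - 1)) / W\<close>.

  The lower bound splits this sum by shuttle. The trips \<open>i, i + S, i + 2 S, \<dots>\<close> can be attributed to
  one shuttle \<open>i\<close>. If \<open>x a\<close> is its load in batch \<open>a\<close>, then it cannot depart in batch \<open>a\<close> before
  \<open>a \<pi> + \<nu> (x 0 + \<dots> + x a)\<close>, and with these departure times its cost is
  \<open>\<pi> \<Sum> a x a + \<nu> (\<Sum> x a)\<^sup>2 / 2 + \<nu> \<Sum> (x a)\<^sup>2 / 2\<close>, a convex function of its loads. By convexity it is best
  to let every shuttle carry the same loads, with total \<open>w = W / S\<close>, and it remains to minimise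
  \<open>\<pi> \<Sum> a x a + \<nu> \<Sum> (x a)\<^sup>2 / 2\<close> subject to \<open>0 \<le> x a \<le> C\<close> and \<open>\<Sum> x a = w\<close>. This is a water filling
  problem: some full batches come first, then a few partially loaded ones whose loads decrease by
  \<open>\<pi> / \<nu>\<close> from batch to batch, and all later batches are empty. Optimality is proved by the
  multiplier conditions in \<open>batch_load_equilibrium\<close> and the tangent bound in
  \<open>shuttle_cost_lower_bound\<close>, which together give \<open>total_cost_lower_bound\<close>. Letting all shuttles of a
  batch depart simultaneously with equal loads is feasible and attains the bound
  (\<open>schedule_feasible_cost\<close>).

  The numbers of full and of partially loaded batches are found by counting loops, and the loads are
  then given by rational expressions. Since \<open>w \<le> W\<close>, the number of batches is bounded in
  terms of the data alone (\<open>batches_bounded\<close>); here \<open>\<pi> > 0\<close> is essential. So the cost of one shuttle,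
  and with it the optimal value, takes constant time, and the solution consists of \<open>S\<close> trips in each
  of a bounded number of batches.
\<close>

section \<open>Water filling for a single shuttle\<close>

text \<open>The loads are found by water filling. In batch \<open>a\<close> a shuttle that loads \<open>x\<close> contributes the convex
cost \<open>a \<pi> x + \<nu> x\<^sup>2 / 2\<close>, with marginal cost \<open>a \<pi> + \<nu> x\<close>; at an optimum all batches that are
neither empty nor full share one marginal cost, the level. Consecutive partially loaded batches
therefore differ in load by \<open>\<pi> / \<nu>\<close>. For \<open>\<nu> = 0\<close> the definition below yields 0, which is the right
convention, because then only one batch is partially loaded.\<close>

definition load_step :: "shuttle_data \<Rightarrow> real" where
  "load_step I = return_time I / load_rate I"

text \<open>The number of batches that the water reaches when the level is \<open>\<nu> C\<close>, that is, when the first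
batch is about to become full. The first batch is counted also if \<open>\<nu> = 0\<close>.\<close>

definition partial_limit :: "shuttle_data \<Rightarrow> nat" where
  "partial_limit I = (LEAST n. 1 \<le> n \<and> load_rate I * capacity I \<le> real n * return_time I)"

text \<open>The amount of water at the level \<open>\<nu> C\<close>: the most that one shuttle can carry in total before its
first batch is full.\<close>

definition unsaturated_max :: "shuttle_data \<Rightarrow> real" where
  "unsaturated_max I = (\<Sum>a<partial_limit I. capacity I - real a * load_step I)"

text \<open>Every batch that becomes full can be split off, since the batches after it solve the same problem
with the level lowered by \<open>\<pi>\<close>. So full batches are removed until the amount left fits below
\<open>unsaturated_max\<close>.\<close>

definition full_batches :: "shuttle_data \<Rightarrow> real \<Rightarrow> nat" where
  "full_batches I w = (LEAST n. w - real n * capacity I \<le> unsaturated_max I)"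

definition remainder :: "shuttle_data \<Rightarrow> real \<Rightarrow> real" where
  "remainder I w = w - real (full_batches I w) * capacity I"

text \<open>Without the capacity constraint, \<open>k\<close> nonempty batches hold at most \<open>\<pi> k (k + 1) / (2 \<nu>)\<close>: at the
level \<open>k \<pi>\<close> the next batch starts to fill. For \<open>\<nu> = 0\<close> the first batch takes everything.\<close>

definition partial_batches :: "shuttle_data \<Rightarrow> real \<Rightarrow> nat" where
  "partial_batches I w =
     (LEAST k. 1 \<le> k \<and> 2 * load_rate I * remainder I w \<le> return_time I * real k * (real k + 1))"

definition batches :: "shuttle_data \<Rightarrow> real \<Rightarrow> nat" where
  "batches I w = full_batches I w + partial_batches I w"

text \<open>The loads form an arithmetic progression with difference \<open>- load_step\<close> and mean
\<open>remainder / partial_batches\<close>.\<close>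

definition partial_load :: "shuttle_data \<Rightarrow> real \<Rightarrow> nat \<Rightarrow> real" where
  "partial_load I w i = remainder I w / real (partial_batches I w)
     + load_step I * ((real (partial_batches I w) - 1) / 2 - real i)"

definition batch_load :: "shuttle_data \<Rightarrow> real \<Rightarrow> nat \<Rightarrow> real" where
  "batch_load I w a =
     (if a < full_batches I w then capacity I
      else if a < batches I w then partial_load I w (a - full_batches I w) else 0)"

text \<open>The earliest possible departure of a shuttle in batch \<open>a\<close>: it has returned \<open>a\<close> times and has loaded
everything it has carried so far, including the current load.\<close>

definition shuttle_departure :: "shuttle_data \<Rightarrow> (nat \<Rightarrow> real) \<Rightarrow> nat \<Rightarrow> real" where
  "shuttle_departure I x a = real a * return_time I + load_rate I * (\<Sum>b\<le>a. x b)"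

definition shuttle_cost :: "shuttle_data \<Rightarrow> real \<Rightarrow> real" where
  "shuttle_cost I w =
     (\<Sum>a<batches I w. batch_load I w a * shuttle_departure I (batch_load I w) a)"

locale constant_demand =
  fixes I :: shuttle_data
  assumes valid: "valid_data I"
    and return_pos: "return_time I > 0"
    and constant_on: "\<And>t. t \<in> {0..period I} \<Longrightarrow> demand I t = total_demand I"
begin

lemma data_bounds: "capacity I > 0" "load_rate I \<ge> 0" "period I \<ge> 0" "total_demand I > 0"
  using valid by (auto simp: valid_data_def)

lemma partial_limit_bounds:
  "1 \<le> partial_limit I"
  "load_rate I * capacity I \<le> real (partial_limit I) * return_time I"
proof -
  obtain n :: nat where "load_rate I * capacity I \<le> real n * return_time I"
    using reals_Archimedean3[OF return_pos] less_imp_le by blast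
  also have "\<dots> \<le> real (Suc n) * return_time I"
    using return_pos by (simp add: algebra_simps)
  finally have "\<exists>n. 1 \<le> n \<and> load_rate I * capacity I \<le> real n * return_time I"
    by (intro exI[of _ "Suc n"]) auto
  from LeastI_ex[OF this]
  show "1 \<le> partial_limit I" "load_rate I * capacity I \<le> real (partial_limit I) * return_time I"
    unfolding partial_limit_def by auto
qed

text \<open>Water at the level \<open>\<nu> C\<close> stands strictly above the bottom of every batch that is counted; only
for the first batch this may fail, namely if \<open>\<nu> = 0\<close>.\<close>

lemma below_partial_limit:
  assumes "1 \<le> a" "a < partial_limit I"
  shows "real a * return_time I < load_rate I * capacity I"
  using not_less_Least[of a "\<lambda>n. 1 \<le> n \<and> load_rate I * capacity I \<le> real n * return_time I"] assms
  unfolding partial_limit_def by auto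

lemma load_rate_step: "load_rate I > 0 \<Longrightarrow> load_rate I * load_step I = return_time I"
  by (simp add: load_step_def)

lemma load_time_less_steps:
  assumes "load_rate I > 0"
  shows "load_rate I * (capacity I - real a * load_step I)
    = load_rate I * capacity I - real a * return_time I"
  using load_rate_step[OF assms] by (simp add: right_diff_distrib mult.left_commute)

lemma step_le_capacity_iff:
  assumes "load_rate I > 0"
  shows "real a * load_step I \<le> capacity I \<longleftrightarrow> real a * return_time I \<le> load_rate I * capacity I"
  using assms by (simp add: load_step_def field_simps)

lemma partial_limit_term_nonneg:
  assumes "a < partial_limit I"
  shows "0 \<le> capacity I - real a * load_step I"
proof (cases "a = 0 \<or> load_rate I = 0")
  case True
  then show ?thesis using data_bounds by (auto simp: load_step_def)
next
  case False
  then have "load_rate I > 0" "1 \<le> a" using data_bounds by auto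
  then show ?thesis
    using below_partial_limit[of a] assms step_le_capacity_iff[of a] by auto
qed

text \<open>The batches that the water does not reach contribute 0 once the progression is truncated. So the
amount at the level \<open>\<nu> C\<close> can be compared with that in a solution that has a different number of
nonempty batches.\<close>

lemma sum_positive_part_le_unsaturated_max:
  assumes "load_rate I > 0"
  shows "(\<Sum>a<n. max 0 (capacity I - real a * load_step I)) \<le> unsaturated_max I"
    and "partial_limit I \<le> n \<Longrightarrow>
      (\<Sum>a<n. max 0 (capacity I - real a * load_step I)) = unsaturated_max I"
proof -
  let ?q = "\<lambda>a. max 0 (capacity I - real a * load_step I)"
  have A: "(\<Sum>a<partial_limit I. ?q a) = unsaturated_max I"
    unfolding unsaturated_max_def using partial_limit_term_nonneg by (intro sum.cong) auto
  have z: "?q a = 0" if "partial_limit I \<le> a" for a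
  proof -
    have "load_rate I * capacity I \<le> real a * return_time I"
      using partial_limit_bounds(2) that return_pos
      by (meson order_trans mult_right_mono of_nat_mono less_imp_le)
    then have "capacity I \<le> real a * load_step I"
      using assms by (simp add: load_step_def field_simps)
    then show ?thesis by simp
  qed
  show eq: "(\<Sum>a<n. ?q a) = unsaturated_max I" if "partial_limit I \<le> n" for n
    unfolding A[symmetric] using z that by (intro sum.mono_neutral_right) auto
  have "(\<Sum>a<n. ?q a) \<le> (\<Sum>a<max n (partial_limit I). ?q a)"
    by (intro sum_mono2) auto
  then show "(\<Sum>a<n. ?q a) \<le> unsaturated_max I" using eq[of "max n (partial_limit I)"] by simp
qed

lemma capacity_le_unsaturated_max: "capacity I \<le> unsaturated_max I"
proof -
  have "(\<Sum>a<1. capacity I - real a * load_step I) \<le> unsaturated_max I"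
    unfolding unsaturated_max_def using partial_limit_bounds partial_limit_term_nonneg
    by (intro sum_mono2) auto
  then show ?thesis by simp
qed

lemma full_batches_exists:
  assumes "w \<le> W" "W \<le> real n * capacity I"
  shows "w - real n * capacity I \<le> unsaturated_max I"
  using assms capacity_le_unsaturated_max data_bounds by simp

lemma remainder_le: "remainder I w \<le> unsaturated_max I"
proof -
  obtain n :: nat where "w < real n * capacity I"
    using reals_Archimedean3[OF data_bounds(1)] by blast
  then have "\<exists>n. w - real n * capacity I \<le> unsaturated_max I"
    using full_batches_exists[of w w n] by auto
  from LeastI_ex[OF this] show ?thesis unfolding remainder_def full_batches_def .
qed

lemma before_full_batches:
  assumes "n < full_batches I w"
  shows "unsaturated_max I < w - real n * capacity I"
  using not_less_Least[OF assms[unfolded full_batches_def]] by simp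

lemma remainder_gt:
  assumes "full_batches I w > 0"
  shows "unsaturated_max I - capacity I < remainder I w"
proof -
  have "unsaturated_max I < w - real (full_batches I w - 1) * capacity I"
    using assms by (intro before_full_batches) auto
  also have "\<dots> = remainder I w + capacity I"
    using assms by (simp add: remainder_def of_nat_diff algebra_simps)
  finally show ?thesis by simp
qed

lemma remainder_pos: "w > 0 \<Longrightarrow> remainder I w > 0"
  using remainder_gt[of w] capacity_le_unsaturated_max
  by (cases "full_batches I w = 0") (auto simp: remainder_def)

lemma remainder_le_total: "remainder I w \<le> w"
  using data_bounds by (simp add: remainder_def)

lemma partial_batches_exists:
  assumes "w \<le> W" "1 \<le> n" "2 * load_rate I * W \<le> real n * return_time I"
  shows "2 * load_rate I * remainder I w \<le> return_time I * real n * (real n + 1)"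
proof -
  have "2 * load_rate I * remainder I w \<le> 2 * load_rate I * W"
    using remainder_le_total[of w] assms(1) data_bounds by (intro mult_left_mono) auto
  also have "\<dots> \<le> real n * return_time I" by fact
  also have "\<dots> \<le> return_time I * real n * (real n + 1)"
    using return_pos by (simp add: algebra_simps)
  finally show ?thesis .
qed

lemma partial_batches_bounds:
  "1 \<le> partial_batches I w"
  "2 * load_rate I * remainder I w
     \<le> return_time I * real (partial_batches I w) * (real (partial_batches I w) + 1)"
proof -
  obtain n :: nat where n: "2 * load_rate I * w < real n * return_time I"
    using reals_Archimedean3[OF return_pos] by blast
  have "2 * load_rate I * w \<le> real (Suc n) * return_time I"
    using n return_pos by (simp add: algebra_simps)
  then have "\<exists>k. 1 \<le> k \<and> 2 * load_rate I * remainder I w \<le> return_time I * real k * (real k + 1)"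
    using partial_batches_exists[of w w "Suc n"] by (intro exI[of _ "Suc n"]) auto
  from LeastI_ex[OF this]
  show "1 \<le> partial_batches I w"
    "2 * load_rate I * remainder I w
     \<le> return_time I * real (partial_batches I w) * (real (partial_batches I w) + 1)"
    unfolding partial_batches_def by auto
qed

lemma before_partial_batches:
  assumes "1 \<le> k" "k < partial_batches I w"
  shows "return_time I * real k * (real k + 1) < 2 * load_rate I * remainder I w"
  using not_less_Least[of k "\<lambda>k. 1 \<le> k \<and>
    2 * load_rate I * remainder I w \<le> return_time I * real k * (real k + 1)"] assms
  unfolding partial_batches_def by auto

lemma partial_batches_no_load_time:
  assumes "load_rate I = 0"
  shows "partial_batches I w = 1"
  using partial_batches_bounds(1)[of w] before_partial_batches[of 1 w] assms return_pos
  by (cases "1 < partial_batches I w") auto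

text \<open>The common marginal cost of the partially loaded batches, counted from the first of them: the
\<open>\<pi>\<close> that each full batch before it adds is left out.\<close>

definition level :: "real \<Rightarrow> real" where
  "level w = load_rate I * remainder I w / real (partial_batches I w)
     + return_time I * (real (partial_batches I w) - 1) / 2"

text \<open>The level lies between the marginal cost of an empty last partial batch and that of an empty next
batch; these two bounds are the two halves of the definition of \<open>partial_batches\<close> as a least number.\<close>

lemma level_le: "level w \<le> real (partial_batches I w) * return_time I"
  using partial_batches_bounds[of w] by (simp add: level_def field_simps)

lemma level_ge:
  assumes "w > 0"
  shows "(real (partial_batches I w) - 1) * return_time I \<le> level w"
proof -
  let ?k = "partial_batches I w"
  have "return_time I * (real ?k - 1) * real ?k \<le> 2 * load_rate I * remainder I w"
  proof (cases "?k = 1")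
    case True
    then show ?thesis using data_bounds remainder_pos[OF assms] by simp
  next
    case False
    then have "1 \<le> ?k - 1" "?k - 1 < ?k" using partial_batches_bounds(1)[of w] by auto
    then show ?thesis
      using before_partial_batches[of "?k - 1" w] by (simp add: of_nat_diff)
  qed
  then show ?thesis using partial_batches_bounds(1)[of w] by (simp add: level_def field_simps)
qed

lemma load_time_partial_load:
  assumes "i < partial_batches I w"
  shows "load_rate I * partial_load I w i = level w - real i * return_time I"
proof (cases "load_rate I = 0")
  case True
  then show ?thesis using partial_batches_no_load_time[of w] assms by (simp add: level_def)
next
  case False
  then have step: "load_rate I * load_step I = return_time I" using data_bounds load_rate_step by auto
  have "load_rate I * partial_load I w i = load_rate I * remainder I w / real (partial_batches I w)
      + (load_rate I * load_step I) * ((real (partial_batches I w) - 1) / 2 - real i)"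
    unfolding partial_load_def distrib_left mult.assoc times_divide_eq_right ..
  then show ?thesis unfolding step by (simp add: level_def right_diff_distrib mult.commute)
qed

lemma sum_partial_load: "(\<Sum>i<partial_batches I w. partial_load I w i) = remainder I w"
proof -
  have gauss: "(\<Sum>i<k. (real k - 1) / 2 - real i) = 0" for k
  proof -
    have "(\<Sum>i<k. real i) = real k * (real k - 1) / 2"
      by (induction k) (auto simp: algebra_simps add_divide_distrib)
    then show ?thesis by (simp add: sum_subtractf)
  qed
  show ?thesis
    using partial_batches_bounds(1)[of w]
    by (simp add: partial_load_def sum.distrib gauss flip: sum_distrib_left)
qed

lemma partial_load_nonneg:
  assumes "w > 0" "i < partial_batches I w"
  shows "0 \<le> partial_load I w i"
proof (cases "load_rate I = 0")
  case True
  then show ?thesis using partial_batches_no_load_time[of w] assms remainder_pos[of w]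
    by (simp add: partial_load_def)
next
  case False
  have "real i * return_time I \<le> (real (partial_batches I w) - 1) * return_time I"
    using assms return_pos by (intro mult_right_mono) auto
  also have "\<dots> \<le> level w" using assms by (intro level_ge)
  finally have "0 \<le> load_rate I * partial_load I w i"
    using load_time_partial_load[OF assms(2)] by simp
  then show ?thesis using False data_bounds by (simp add: zero_le_mult_iff)
qed

lemma partial_load_le_first: "partial_load I w i \<le> partial_load I w 0"
proof -
  have "0 \<le> load_step I" using data_bounds return_pos by (simp add: load_step_def)
  then show ?thesis unfolding partial_load_def
    by (intro add_left_mono mult_left_mono diff_left_mono) auto
qed

text \<open>If the first load exceeded the capacity, the level would be above \<open>\<nu> C\<close>. Then every nonempty
batch would hold more than it does at the level \<open>\<nu> C\<close>, and the total would exceed \<open>unsaturated_max\<close>, whereas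
\<open>remainder\<close> does not.\<close>

lemma partial_load_le_capacity:
  assumes "w > 0" "i < partial_batches I w"
  shows "partial_load I w i \<le> capacity I"
proof -
  let ?k = "partial_batches I w" and ?q = "\<lambda>a. max 0 (capacity I - real a * load_step I)"
  have "partial_load I w 0 \<le> capacity I"
  proof (cases "load_rate I = 0")
    case True
    then have "partial_limit I = 1"
      using below_partial_limit[of 1] partial_limit_bounds(1) return_pos
      by (cases "1 < partial_limit I") auto
    then show ?thesis
      using True partial_batches_no_load_time[of w] remainder_le[of w]
      by (simp add: partial_load_def unsaturated_max_def)
  next
    case False
    then have pos: "load_rate I > 0" using data_bounds by simp
    have k: "0 < ?k" using partial_batches_bounds(1)[of w] by simp
    show ?thesis
    proof (rule ccontr)
      assume gt: "\<not> partial_load I w 0 \<le> capacity I"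
      \<comment> \<open>The level exceeds \<open>\<nu> C\<close>, so at least \<open>partial_limit I\<close> batches are under water.\<close>
      have lv: "load_rate I * capacity I < level w"
        using gt load_time_partial_load[OF k]
          mult_strict_left_mono[OF _ pos, of "capacity I" "partial_load I w 0"]
        by simp
      have "partial_limit I \<le> ?k"
        using below_partial_limit[of ?k] level_le[of w] lv k by (cases "?k < partial_limit I") auto
      note A = sum_positive_part_le_unsaturated_max(2)[OF pos this]
      have "(\<Sum>i<?k. ?q i) < (\<Sum>i<?k. partial_load I w i)"
      proof (rule sum_strict_mono_ex1)
        show "\<forall>i\<in>{..<?k}. ?q i \<le> partial_load I w i"
        proof
          fix i assume i: "i \<in> {..<?k}"
          have "load_rate I * (capacity I - real i * load_step I) \<le> load_rate I * partial_load I w i"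
            using lv load_time_partial_load[of i w] i unfolding load_time_less_steps[OF pos]
            by simp
          then show "?q i \<le> partial_load I w i"
            using pos partial_load_nonneg[OF assms(1)] i by simp
        qed
        show "\<exists>i\<in>{..<?k}. ?q i < partial_load I w i"
          using gt k data_bounds by (intro bexI[of _ 0]) auto
      qed simp
      then show False using A sum_partial_load[of w] remainder_le[of w] by simp
    qed
  qed
  then show ?thesis using partial_load_le_first[of w i] by simp
qed

text \<open>This inequality says that the last full batch is rightly full: its marginal cost \<open>\<nu> C - \<pi>\<close>,
measured from the first partial batch, does not exceed the level. Otherwise the partial batches
would hold no more than what \<open>unsaturated_max\<close> allots to the batches after the first one, and one
full batch fewer would have sufficed.\<close>

lemma level_ge_if_full:
  assumes "full_batches I w > 0"
  shows "load_rate I * capacity I - return_time I \<le> level w"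
proof (rule ccontr)
  let ?k = "partial_batches I w" and ?q = "\<lambda>a. max 0 (capacity I - real a * load_step I)"
  assume less: "\<not> load_rate I * capacity I - return_time I \<le> level w"
  have pos: "load_rate I > 0"
  proof (rule ccontr)
    assume "\<not> load_rate I > 0"
    then have "load_rate I = 0" using data_bounds by simp
    then show False using less return_pos partial_batches_no_load_time[of w]
      by (simp add: level_def)
  qed
  have "partial_load I w i \<le> ?q (Suc i)" if "i < ?k" for i
  proof -
    have "load_rate I * partial_load I w i \<le> load_rate I * (capacity I - real (Suc i) * load_step I)"
      using less load_time_partial_load[OF that]
      unfolding load_time_less_steps[OF pos] by (simp add: algebra_simps)
    then show ?thesis using pos by simp
  qed
  then have "remainder I w \<le> (\<Sum>i<?k. ?q (Suc i))"
    unfolding sum_partial_load[symmetric] by (intro sum_mono) auto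
  also have "\<dots> = (\<Sum>i<Suc ?k. ?q i) - capacity I"
    using data_bounds by (subst sum.lessThan_Suc_shift) simp
  also have "\<dots> \<le> unsaturated_max I - capacity I"
    using sum_positive_part_le_unsaturated_max(1)[OF pos, of "Suc ?k"] by linarith
  finally show False using remainder_gt[OF assms] by simp
qed

lemma batch_load_bounds:
  assumes "w > 0"
  shows "0 \<le> batch_load I w a" "batch_load I w a \<le> capacity I"
  using data_bounds partial_load_nonneg[OF assms] partial_load_le_capacity[OF assms]
  by (auto simp: batch_load_def batches_def)

lemma batch_load_beyond: "batches I w \<le> a \<Longrightarrow> batch_load I w a = 0"
  by (auto simp: batch_load_def batches_def)

lemma sum_batch_load:
  assumes "batches I w \<le> n"
  shows "(\<Sum>a<n. batch_load I w a) = w"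
proof -
  let ?s = "full_batches I w" and ?k = "partial_batches I w"
  have split: "(\<Sum>a<s + k. f a) = (\<Sum>a<s. f a) + (\<Sum>i<k. f (s + i))"
    for s k and f :: "nat \<Rightarrow> real"
    by (induction k) auto
  have "(\<Sum>a<n. batch_load I w a) = (\<Sum>a<?s + ?k. batch_load I w a)"
    using assms by (intro sum.mono_neutral_right) (auto simp: batch_load_beyond batches_def)
  also have "\<dots> = (\<Sum>a<?s. batch_load I w a) + (\<Sum>i<?k. batch_load I w (?s + i))"
    by (rule split)
  also have "(\<Sum>i<?k. batch_load I w (?s + i)) = remainder I w"
    unfolding sum_partial_load[symmetric]
    by (intro sum.cong) (auto simp: batch_load_def batches_def)
  also have "(\<Sum>a<?s. batch_load I w a) = real ?s * capacity I"
    by (simp add: batch_load_def)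
  finally show ?thesis by (simp add: remainder_def)
qed

text \<open>The Karush-Kuhn-Tucker conditions in the form used below: shifting load between batches does not
pay. The multiplier is the level, now counted from the first batch.\<close>

lemma batch_load_equilibrium:
  assumes "w > 0"
  obtains \<mu> where "\<And>a z. 0 \<le> z \<Longrightarrow> z \<le> capacity I \<Longrightarrow>
    \<mu> * (z - batch_load I w a)
      \<le> (real a * return_time I + load_rate I * batch_load I w a) * (z - batch_load I w a)"
proof
  let ?s = "full_batches I w" and ?k = "partial_batches I w"
  let ?\<mu> = "real ?s * return_time I + level w"
  fix a :: nat and z :: real
  assume z: "0 \<le> z" "z \<le> capacity I"
  consider "a < ?s" | "?s \<le> a" "a - ?s < ?k" | "?s + ?k \<le> a" by linarith
  then show "?\<mu> * (z - batch_load I w a)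
      \<le> (real a * return_time I + load_rate I * batch_load I w a) * (z - batch_load I w a)"
  proof cases
    case 1
    then have "real (Suc a) * return_time I \<le> real ?s * return_time I"
      using return_pos by (intro mult_right_mono) auto
    then have "real a * return_time I + load_rate I * capacity I \<le> ?\<mu>"
      using level_ge_if_full[of w] 1 by (simp add: algebra_simps)
    then show ?thesis using 1 z by (simp add: batch_load_def mult_right_mono_neg)
  next
    case 2
    then have "a < ?s + ?k" by linarith
    with 2 have "?\<mu> = real a * return_time I + load_rate I * batch_load I w a"
      using load_time_partial_load[of "a - ?s" w]
      by (simp add: batch_load_def batches_def of_nat_diff algebra_simps)
    then show ?thesis by simp
  next
    case 3
    then have "real (?s + ?k) * return_time I \<le> real a * return_time I"
      using return_pos by (intro mult_right_mono) auto
    then have "?\<mu> \<le> real a * return_time I"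
      using level_le[of w] by (simp add: algebra_simps)
    then show ?thesis using 3 z batch_load_beyond[of w a]
      by (simp add: batches_def mult_right_mono)
  qed
qed

end

section \<open>Lower bound on the total cost\<close>

text \<open>With constant demand every passenger is present from time 0, so the objective is
\<open>total_cost / D(T)\<close>.\<close>

definition total_cost :: "(nat \<Rightarrow> real) \<Rightarrow> (nat \<Rightarrow> real) \<Rightarrow> ereal" where
  "total_cost d y = (\<Sum>j. ereal ((y (Suc j) - y j) * d (Suc j)))"

text \<open>Trip \<open>a S + i\<close> (counted from 0) is made by shuttle \<open>i\<close> in batch \<open>a\<close>; the trips are regrouped by
shuttle.\<close>

lemma sum_rounds:
  fixes f :: "nat \<Rightarrow> real"
  shows "(\<Sum>j<n * S. f j) = (\<Sum>i<S. \<Sum>a<n. f (a * S + i))"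
proof -
  have "(\<Sum>j<n * S. f j) = (\<Sum>a<n. \<Sum>j = a * S..<a * S + S. f j)"
    by (simp add: sum.nat_group)
  also have "\<dots> = (\<Sum>a<n. \<Sum>i<S. f (a * S + i))"
    using sum.shift_bounds_nat_ivl[of f 0 _ S]
    by (intro sum.cong[OF refl])
       (simp add: add.commute[of S] add.commute[of _ "_ * S"] atLeast0LessThan)
  finally show ?thesis by (simp add: sum.swap[of _ "{..<S}"])
qed

lemma div_add_block: "S \<ge> 1 \<Longrightarrow> (j + S) div S = Suc (j div S)" for j S :: nat
  by simp

lemma sum_mult_partial_sums:
  fixes x :: "nat \<Rightarrow> real"
  shows "2 * (\<Sum>a<n. x a * (\<Sum>b\<le>a. x b)) = (\<Sum>a<n. x a)\<^sup>2 + (\<Sum>a<n. (x a)\<^sup>2)"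
  by (induction n) (auto simp: algebra_simps power2_eq_square lessThan_Suc_atMost[symmetric])

text \<open>The bilinear term \<open>\<Sum> x a (\<Sum>b\<le>a. x b)\<close> becomes a sum of squares, which exposes the cost of a shuttle
as a convex function of its loads.\<close>

lemma sum_mult_shuttle_departure:
  "2 * (\<Sum>a<n. x a * shuttle_departure I x a)
     = (\<Sum>a<n. 2 * real a * return_time I * x a + load_rate I * (x a)\<^sup>2)
       + load_rate I * (\<Sum>a<n. x a)\<^sup>2"
proof -
  have "2 * (\<Sum>a<n. x a * shuttle_departure I x a)
     = (\<Sum>a<n. 2 * real a * return_time I * x a)
       + load_rate I * (2 * (\<Sum>a<n. x a * (\<Sum>b\<le>a. x b)))"
    by (simp add: shuttle_departure_def sum_distrib_left algebra_simps sum.distrib)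
  then show ?thesis
    unfolding sum_mult_partial_sums by (simp add: sum.distrib sum_distrib_left algebra_simps)
qed

context constant_demand begin

text \<open>Tangent line bound for one shuttle. Both squares are replaced by their tangents at the water
filling solution, and the equilibrium condition bounds the linear part. Only the total load of the
shuttle survives on the left, and it enters linearly; so after summation over all shuttles only
the total load matters, and it is irrelevant how the demand is split among the shuttles.\<close>

lemma shuttle_cost_lower_bound:
  assumes "w > 0"
    and equilibrium: "\<And>a z. 0 \<le> z \<Longrightarrow> z \<le> capacity I \<Longrightarrow>
      \<mu> * (z - batch_load I w a)
        \<le> (real a * return_time I + load_rate I * batch_load I w a) * (z - batch_load I w a)"
    and n: "batches I w \<le> n"
    and x: "\<And>a. a < n \<Longrightarrow> 0 \<le> x a" "\<And>a. a < n \<Longrightarrow> x a \<le> capacity I"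
    and e: "\<And>a. a < n \<Longrightarrow> shuttle_departure I x a \<le> e a"
  shows "shuttle_cost I w + (\<mu> + load_rate I * w) * ((\<Sum>a<n. x a) - w) \<le> (\<Sum>a<n. x a * e a)"
proof -
  let ?X = "batch_load I w" and ?\<nu> = "load_rate I" and ?p = "return_time I"
  have X: "(\<Sum>a<n. ?X a) = w" using sum_batch_load[OF n] .
  have cost: "shuttle_cost I w = (\<Sum>a<n. ?X a * shuttle_departure I ?X a)"
    unfolding shuttle_cost_def using n
    by (intro sum.mono_neutral_left) (auto simp: batch_load_beyond)
  have square: "?\<nu> * u\<^sup>2 + 2 * ?\<nu> * u * (v - u) \<le> ?\<nu> * v\<^sup>2" for u v
  proof -
    have "0 \<le> ?\<nu> * (v - u)\<^sup>2" using data_bounds by simp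
    then show ?thesis by (simp add: power2_eq_square algebra_simps)
  qed
  have "2 * real a * ?p * ?X a + ?\<nu> * (?X a)\<^sup>2 + 2 * \<mu> * (x a - ?X a)
      \<le> 2 * real a * ?p * x a + ?\<nu> * (x a)\<^sup>2" if "a < n" for a
    using equilibrium[of "x a" a] x[OF that] square[of "?X a" "x a"]
    by (simp add: algebra_simps)
  then have "(\<Sum>a<n. 2 * real a * ?p * ?X a + ?\<nu> * (?X a)\<^sup>2 + 2 * \<mu> * (x a - ?X a))
      \<le> (\<Sum>a<n. 2 * real a * ?p * x a + ?\<nu> * (x a)\<^sup>2)"
    by (intro sum_mono) auto
  then have "(\<Sum>a<n. 2 * real a * ?p * ?X a + ?\<nu> * (?X a)\<^sup>2) + 2 * \<mu> * ((\<Sum>a<n. x a) - w)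
      \<le> (\<Sum>a<n. 2 * real a * ?p * x a + ?\<nu> * (x a)\<^sup>2)"
    by (simp add: sum.distrib sum_subtractf X flip: sum_distrib_left)
  then have "2 * shuttle_cost I w + 2 * (\<mu> + ?\<nu> * w) * ((\<Sum>a<n. x a) - w)
      \<le> 2 * (\<Sum>a<n. x a * shuttle_departure I x a)"
    unfolding cost sum_mult_shuttle_departure X using square[of w "\<Sum>a<n. x a"]
    by (simp add: algebra_simps)
  also have "(\<Sum>a<n. x a * shuttle_departure I x a) \<le> (\<Sum>a<n. x a * e a)"
    using e x by (intro sum_mono mult_left_mono) auto
  finally have "2 * (shuttle_cost I w + (\<mu> + ?\<nu> * w) * ((\<Sum>a<n. x a) - w))
      \<le> 2 * (\<Sum>a<n. x a * e a)"
    by (simp add: algebra_simps)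
  then show ?thesis by simp
qed

lemma taubar_zero: "y \<le> total_demand I \<Longrightarrow> taubar I y = 0"
proof -
  assume "y \<le> total_demand I"
  then have "{t \<in> {0..period I}. demand I t \<ge> y} = {0..period I}" using constant_on by auto
  then show ?thesis using data_bounds by (simp add: taubar_def)
qed

lemma feasible_mono:
  assumes "feasible I S d y"
  shows "mono y"
  unfolding mono_iff_le_Suc
proof
  fix n
  have "\<forall>j\<ge>1. y (j - 1) \<le> y j" using assms by (simp add: feasible_def)
  from this[rule_format, of "Suc n"] show "y n \<le> y (Suc n)" by simp
qed

lemma feasible_le_total:
  assumes f: "feasible I S d y"
  shows "y j \<le> total_demand I"
  using f incseq_le[OF feasible_mono[OF f], of _ j] unfolding feasible_def by auto

lemma g_ave_eq_total_cost:
  assumes f: "feasible I S d y"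
  shows "g_ave I d y = ereal (1 / total_demand I) * total_cost d y"
proof -
  have "integral {y j..y (Suc j)} (\<lambda>u. d (Suc j) - taubar I u) = (y (Suc j) - y j) * d (Suc j)" for j
  proof -
    have "integral {y j..y (Suc j)} (\<lambda>u. d (Suc j) - taubar I u)
        = integral {y j..y (Suc j)} (\<lambda>u. d (Suc j))"
      using feasible_le_total[OF f, of "Suc j"] by (intro integral_cong) (auto simp: taubar_zero)
    then show ?thesis
      using feasible_mono[OF f, THEN monoD, of j "Suc j"] by simp
  qed
  then show ?thesis by (simp add: g_ave_def total_cost_def)
qed

text \<open>Departures of the same shuttle are linked by its return time and its loading times.\<close>

lemma feasible_departure_ge:
  assumes f: "feasible I S d y"
  shows "shuttle_departure I (\<lambda>b. y (Suc (b * S + i)) - y (b * S + i)) a \<le> d (Suc (a * S + i))"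
proof (induction a)
  case 0
  have "taubar I (y (Suc i)) + load_rate I * (y (Suc i) - y (Suc i - 1)) \<le> d (Suc i)"
    using f unfolding feasible_def by (metis One_nat_def le_add1 plus_1_eq_Suc)
  then show ?case
    using taubar_zero[OF feasible_le_total[OF f]] by (simp add: shuttle_departure_def)
next
  case (Suc a)
  have "d (Suc (a * S + i)) + return_time I
      + load_rate I * (y (Suc (a * S + i) + S) - y (Suc (a * S + i) + S - 1))
      \<le> d (Suc (a * S + i) + S)"
    using f unfolding feasible_def by (metis One_nat_def le_add1 plus_1_eq_Suc)
  with Suc show ?case by (simp add: shuttle_departure_def algebra_simps)
qed

text \<open>The number of batches of a feasible solution may be infinite. The tangent bound is applied to the
first \<open>n\<close> batches; its error term is proportional to the demand still to be served and vanishes as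
\<open>n\<close> grows.\<close>

lemma total_cost_lower_bound:
  assumes f: "feasible I S d y" and S: "S \<ge> 1"
  shows "ereal (real S * shuttle_cost I (total_demand I / real S)) \<le> total_cost d y"
proof -
  let ?W = "total_demand I" and ?w = "total_demand I / real S"
  let ?x = "\<lambda>j. y (Suc j) - y j"
  have w: "?w > 0" using data_bounds S by simp
  obtain \<mu> where equilibrium: "\<And>a z. 0 \<le> z \<Longrightarrow> z \<le> capacity I \<Longrightarrow>
      \<mu> * (z - batch_load I ?w a)
        \<le> (real a * return_time I + load_rate I * batch_load I ?w a) * (z - batch_load I ?w a)"
    using batch_load_equilibrium[OF w] by blast
  have x: "0 \<le> ?x j" "?x j \<le> capacity I" for j
  proof -
    show "0 \<le> ?x j" using feasible_mono[OF f, THEN monoD, of j "Suc j"] by simp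
    show "?x j \<le> capacity I"
      using f unfolding feasible_def by (metis One_nat_def diff_Suc_1 le_add1 plus_1_eq_Suc)
  qed
  have d: "0 \<le> d (Suc j)" for j using f unfolding feasible_def by auto
  let ?low = "\<lambda>n. real S * shuttle_cost I ?w + (\<mu> + load_rate I * ?w) * (y (n * S) - ?W)"
  have low: "ereal (?low n) \<le> total_cost d y" if n: "batches I ?w \<le> n" for n
  proof -
    have "y (n * S) = (\<Sum>j<n * S. ?x j)"
      using f unfolding feasible_def by (simp add: sum_lessThan_telescope)
    also have "\<dots> = (\<Sum>i<S. \<Sum>a<n. ?x (a * S + i))" by (rule sum_rounds)
    finally have y: "y (n * S) = \<dots>" .
    have "?low n = (\<Sum>i<S. shuttle_cost I ?w
        + (\<mu> + load_rate I * ?w) * ((\<Sum>a<n. ?x (a * S + i)) - ?w))"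
      using S by (simp add: y sum.distrib sum_subtractf flip: sum_distrib_left)
    also have "\<dots> \<le> (\<Sum>i<S. \<Sum>a<n. ?x (a * S + i) * d (Suc (a * S + i)))"
      using x feasible_departure_ge[OF f]
      by (intro sum_mono shuttle_cost_lower_bound[OF w equilibrium n]) auto
    also have "\<dots> = (\<Sum>j<n * S. ?x j * d (Suc j))"
      by (rule sum_rounds[symmetric])
    finally have "ereal (?low n) \<le> (\<Sum>j<n * S. ereal (?x j * d (Suc j)))"
      by simp
    also have "\<dots> \<le> total_cost d y"
      unfolding total_cost_def using x d by (intro suminf_upper) auto
    finally show ?thesis .
  qed
  have "y \<longlonglongrightarrow> ?W" using f by (simp add: feasible_def)
  moreover have "strict_mono (\<lambda>n. n * S)" using S by (auto intro!: strict_monoI)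
  ultimately have "(\<lambda>n. y (n * S)) \<longlonglongrightarrow> ?W"
    using LIMSEQ_subseq_LIMSEQ[of y ?W "\<lambda>n. n * S"] by (simp add: comp_def)
  then have "?low \<longlonglongrightarrow> real S * shuttle_cost I ?w + (\<mu> + load_rate I * ?w) * (?W - ?W)"
    by (intro tendsto_intros)
  then have "(\<lambda>n. ereal (?low n)) \<longlonglongrightarrow> ereal (real S * shuttle_cost I ?w)" by simp
  then show ?thesis
    by (rule Lim_bounded[where M = "batches I ?w"]) (use low in auto)
qed

end

section \<open>A schedule that attains the bound\<close>

definition interleave :: "(nat \<Rightarrow> 'a) \<Rightarrow> (nat \<Rightarrow> 'a) \<Rightarrow> nat \<Rightarrow> 'a list" where
  "interleave f g n = concat (map (\<lambda>j. [f j, g j]) [0..<n])"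

lemma interleave_0 [simp]: "interleave f g 0 = []"
  by (simp add: interleave_def)

lemma interleave_Suc [simp]: "interleave f g (Suc n) = interleave f g n @ [f n, g n]"
  by (simp add: interleave_def)

lemma length_interleave [simp]: "length (interleave f g n) = 2 * n"
  by (induction n) auto

lemma nth_interleave:
  assumes "j < n"
  shows "interleave f g n ! (2 * j) = f j" "interleave f g n ! (2 * j + 1) = g j"
  using assms by (induction n) (auto simp: nth_append less_Suc_eq)

lemma decode_d_interleave:
  assumes "n \<ge> 1"
  shows "decode_d I (interleave f g n) (Suc j) =
    (if j < n then f j else f (n - 1) + real (Suc j - n) * return_time I)"
  using assms nth_interleave(1)[of j n f g] nth_interleave(1)[of "n - 1" n f g]
  by (auto simp: decode_d_def)

lemma decode_y_interleave:
  assumes "n \<ge> 1"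
  shows "decode_y (interleave f g n) 0 = 0"
    and "decode_y (interleave f g n) (Suc j) = g (min j (n - 1))"
  using assms nth_interleave(2)[of "min j (n - 1)" n f g]
  by (auto simp: decode_y_def min_def Let_def split: if_splits)

definition cumulative_load :: "nat \<Rightarrow> (nat \<Rightarrow> real) \<Rightarrow> nat \<Rightarrow> real" where
  "cumulative_load S x j = (\<Sum>i<j. x (i div S))"

text \<open>Trip \<open>j\<close>, counted from 0, belongs to batch \<open>j div S\<close>. All shuttles of a batch carry the same load,
so the earliest departures of the individual shuttles coincide and the order of departures delays
none of them.\<close>

definition schedule_output :: "shuttle_data \<Rightarrow> nat \<Rightarrow> (nat \<Rightarrow> real) \<Rightarrow> nat \<Rightarrow> real list" where
  "schedule_output I S x =
     interleave (\<lambda>j. shuttle_departure I x (j div S)) (\<lambda>j. cumulative_load S x (Suc j))"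

context constant_demand begin

lemma batches_pos: "1 \<le> batches I w"
  using partial_batches_bounds(1)[of w] by (simp add: batches_def)

lemma shuttle_departure_Suc:
  "shuttle_departure I x (Suc a) = shuttle_departure I x a + return_time I + load_rate I * x (Suc a)"
  by (simp add: shuttle_departure_def algebra_simps)

lemma shuttle_departure_mono:
  assumes "\<And>a. 0 \<le> x a" "a \<le> b"
  shows "shuttle_departure I x a \<le> shuttle_departure I x b"
  using assms(2)
proof (induction rule: dec_induct)
  case (step n)
  then show ?case
    using mult_nonneg_nonneg[OF data_bounds(2) assms(1)[of "Suc n"]] return_pos
    by (simp add: shuttle_departure_Suc)
qed simp

lemma cumulative_load_eq_total:
  assumes "S \<ge> 1" "batches I w * S \<le> j"
  shows "cumulative_load S (batch_load I w) j = real S * w"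
proof -
  let ?n = "batches I w * S"
  have "cumulative_load S (batch_load I w) j = (\<Sum>i<?n. batch_load I w (i div S))"
    unfolding cumulative_load_def using assms
    by (intro sum.mono_neutral_right)
       (auto intro!: batch_load_beyond simp: less_eq_div_iff_mult_less_eq)
  also have "\<dots> = real S * w"
    using assms by (simp add: sum_rounds sum_batch_load)
  finally show ?thesis .
qed

text \<open>After the last batch nothing is left to be loaded, so the continuation by departures at intervals
of \<open>\<pi>\<close> is feasible and costs nothing.\<close>

lemma schedule_feasible_cost:
  fixes S :: nat
  assumes S: "S \<ge> 1"
  defines "w \<equiv> total_demand I / real S"
  defines "d \<equiv> decode_d I (schedule_output I S (batch_load I w) (batches I w * S))"
    and "y \<equiv> decode_y (schedule_output I S (batch_load I w) (batches I w * S))"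
  shows "feasible I S d y"
    and "total_cost d y = ereal (real S * shuttle_cost I w)"
proof -
  let ?X = "batch_load I w" and ?N = "batches I w"
  let ?n = "?N * S" and ?D = "shuttle_departure I (batch_load I w)"
  have w: "w > 0" using data_bounds S by (simp add: w_def)
  have n: "?n \<ge> 1" using batches_pos[of w] S by (simp add: Suc_le_eq)
  have last: "(?n - 1) div S = ?N - 1"
  proof (rule div_nat_eqI)
    show "S * (?N - 1) \<le> ?n - 1" using S n by (simp add: algebra_simps)
    show "?n - 1 < S * Suc (?N - 1)" using n batches_pos[of w] by (simp add: mult.commute)
  qed
  have X: "0 \<le> ?X a" "?X a \<le> capacity I" for a using batch_load_bounds[OF w] by auto
  have Xn: "?X (j div S) = 0" if "?n \<le> j" for j
    using that S by (intro batch_load_beyond) (simp add: less_eq_div_iff_mult_less_eq)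
  have D_mono: "?D a \<le> ?D b" if "a \<le> b" for a b
    using shuttle_departure_mono[OF X(1) that] .
  have D_ge: "load_rate I * ?X a \<le> ?D a" for a
  proof -
    have "?X a \<le> (\<Sum>b\<le>a. ?X b)" using X by (intro member_le_sum) auto
    then have "load_rate I * ?X a \<le> load_rate I * (\<Sum>b\<le>a. ?X b)"
      using data_bounds by (intro mult_left_mono) auto
    then show ?thesis using return_pos by (simp add: shuttle_departure_def add_increasing)
  qed
  have d: "d (Suc j) = (if j < ?n then ?D (j div S)
      else ?D (?N - 1) + real (Suc j - ?n) * return_time I)" for j
    unfolding d_def schedule_output_def decode_d_interleave[OF n] last ..
  have y: "y = cumulative_load S ?X"
  proof
    fix j
    show "y j = cumulative_load S ?X j"
    proof (cases j)
      case 0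
      then show ?thesis
        by (simp add: y_def schedule_output_def decode_y_interleave[OF n] cumulative_load_def)
    next
      case (Suc i)
      have "cumulative_load S ?X (Suc i) = cumulative_load S ?X (Suc (min i (?n - 1)))"
      proof (cases "i < ?n")
        case False
        then have "Suc (min i (?n - 1)) = ?n" using n by simp
        then show ?thesis using False cumulative_load_eq_total[OF S] by simp
      qed (use n in simp)
      then show ?thesis
        using Suc by (simp add: y_def schedule_output_def decode_y_interleave[OF n])
    qed
  qed
  have step: "y (Suc j) - y j = ?X (j div S)" for j
    by (simp add: y cumulative_load_def)
  have y_total: "y j = total_demand I" if "?n \<le> j" for j
    using cumulative_load_eq_total[OF S that] S by (simp add: y w_def)
  have y_nonneg: "0 \<le> y j" for j unfolding y cumulative_load_def using X by (intro sum_nonneg) auto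
  have y_le: "y j \<le> total_demand I" for j
    unfolding y_total[of "j + ?n", symmetric, simplified] unfolding y cumulative_load_def
    using X by (intro sum_mono2) auto
  have D_last: "?D (j div S) \<le> ?D (?N - 1)" if "j < ?n" for j
  proof (rule D_mono)
    have "j div S < ?N" using that by (simp add: less_mult_imp_div_less)
    then show "j div S \<le> ?N - 1" by simp
  qed
  have d_mono: "d (Suc j) \<le> d (Suc (Suc j))" for j
  proof -
    have "real (Suc j - ?n) * return_time I \<le> real (Suc (Suc j) - ?n) * return_time I"
      using return_pos by (intro mult_right_mono) auto
    moreover have "0 \<le> real (Suc (Suc j) - ?n) * return_time I"
      using return_pos by simp
    ultimately show ?thesis
      unfolding d using D_mono[OF div_le_mono[of j "Suc j" S]] D_last[of j] by auto
  qed
  have d_ge: "load_rate I * ?X (j div S) \<le> d (Suc j)" for j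
  proof (cases "j < ?n")
    case True
    then show ?thesis using D_ge by (simp add: d)
  next
    case False
    have "0 \<le> ?D (?N - 1)" using order_trans[OF mult_nonneg_nonneg D_ge] X data_bounds by blast
    moreover have "0 \<le> real (Suc j - ?n) * return_time I" using return_pos by simp
    ultimately show ?thesis using False Xn[of j] unfolding d by simp
  qed
  have d_return: "d (Suc j) + return_time I + load_rate I * ?X (Suc (j div S)) \<le> d (Suc (j + S))" for j
  proof (cases "j + S < ?n")
    case True
    then show ?thesis using div_add_block[OF S] by (simp add: d shuttle_departure_Suc)
  next
    case False
    have X0: "?X (Suc (j div S)) = 0" using Xn[of "j + S"] False div_add_block[OF S] by simp
    have "Suc j - ?n + 1 \<le> Suc (j + S) - ?n" using False S by linarith
    then have "real (Suc j - ?n) + 1 \<le> real (Suc (j + S) - ?n)"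
      by (metis of_nat_1 of_nat_add of_nat_mono)
    from mult_right_mono[OF this less_imp_le[OF return_pos]]
    have le: "real (Suc j - ?n) * return_time I + return_time I
        \<le> real (Suc (j + S) - ?n) * return_time I"
      by (simp only: distrib_right mult_1_left)
    have "d (Suc j) \<le> ?D (?N - 1) + real (Suc j - ?n) * return_time I"
      unfolding d using D_last[of j] by simp
    also have "\<dots> + return_time I \<le> d (Suc (j + S))"
      unfolding d using False le by simp
    finally show ?thesis using X0 by simp
  qed
  \<comment> \<open>Shifted indices remove the truncated subtractions from the constraints.\<close>
  have all_Suc: "(\<forall>j\<ge>1. P j) \<longleftrightarrow> (\<forall>j. P (Suc j))" for P :: "nat \<Rightarrow> bool"
    by (metis One_nat_def Suc_le_D le_add1 plus_1_eq_Suc)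
  have all_Suc2: "(\<forall>j\<ge>2. P j) \<longleftrightarrow> (\<forall>j. P (Suc (Suc j)))" for P :: "nat \<Rightarrow> bool"
    by (metis Suc_le_D Suc_le_mono numeral_2_eq_2 le0)
  show f: "feasible I S d y"
    unfolding feasible_def all_Suc all_Suc2
  proof (intro conjI allI)
    fix j
    show "0 \<le> d (Suc j)"
      using order_trans[OF mult_nonneg_nonneg d_ge] X data_bounds by blast
    show "y \<longlonglongrightarrow> total_demand I"
      using y_total by (intro tendsto_eventually eventually_sequentiallyI[of ?n])
    show "taubar I (y (Suc j)) + load_rate I * (y (Suc j) - y (Suc j - 1)) \<le> d (Suc j)"
      using d_ge step y_le by (simp add: taubar_zero)
    show "d (Suc j) + return_time I + load_rate I * (y (Suc j + S) - y (Suc j + S - 1))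
        \<le> d (Suc j + S)"
      using d_return[of j] step[of "j + S"] div_add_block[OF S] by simp
    show "y (Suc j) - y (Suc j - 1) \<le> capacity I" "y (Suc j - 1) \<le> y (Suc j)"
      using X[of "j div S"] step[of j] by auto
    show "d (Suc (Suc j) - 1) \<le> d (Suc (Suc j))" using d_mono by simp
    show "0 \<le> y (Suc j)" by (rule y_nonneg)
    show "y 0 = 0" by (simp add: y cumulative_load_def)
  qed
  have "total_cost d y = (\<Sum>j<?n. ereal ((y (Suc j) - y j) * d (Suc j)))"
    unfolding total_cost_def using Xn by (intro suminf_finite) (auto simp: step)
  also have "\<dots> = ereal (\<Sum>j<?n. ?X (j div S) * ?D (j div S))"
    by (simp add: step d)
  also have "(\<Sum>j<?n. ?X (j div S) * ?D (j div S)) = real S * shuttle_cost I w"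
    using S by (simp add: sum_rounds shuttle_cost_def)
  finally show "total_cost d y = ereal (real S * shuttle_cost I w)" .
qed

lemma optimum:
  fixes S :: nat
  assumes S: "S \<ge> 1"
  defines "w \<equiv> total_demand I / real S"
  defines "out \<equiv> schedule_output I S (batch_load I w) (batches I w * S)"
  shows "optimal_solution I S (decode_d I out) (decode_y out)"
    and "optimal_value I S = ereal (real S * shuttle_cost I w / total_demand I)"
proof -
  let ?d = "decode_d I out" and ?y = "decode_y out"
  note sched = schedule_feasible_cost[OF S, folded w_def, folded out_def]
  have "ereal (1 / total_demand I) * total_cost ?d ?y \<le> ereal (1 / total_demand I) * total_cost d y"
    if "feasible I S d y" for d y
    using total_cost_lower_bound[OF that S] sched(2) data_bounds
    by (intro ereal_mult_left_mono) (auto simp: w_def)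
  then have le: "g_ave I ?d ?y \<le> g_ave I d y" if "feasible I S d y" for d y
    using that by (simp add: g_ave_eq_total_cost[OF sched(1)] g_ave_eq_total_cost[OF that])
  show "optimal_solution I S ?d ?y"
    unfolding optimal_solution_def using sched(1) le by blast
  have "optimal_value I S = g_ave I ?d ?y"
    unfolding optimal_value_def using sched(1) le
    by (intro antisym Inf_lower Inf_greatest) auto
  then show "optimal_value I S = ereal (real S * shuttle_cost I w / total_demand I)"
    by (simp add: g_ave_eq_total_cost[OF sched(1)] sched(2))
qed

end

section \<open>Executing programs within a time bound\<close>

definition halts_within :: "shuttle_data \<Rightarrow> prog \<Rightarrow> state \<Rightarrow> nat \<Rightarrow> state \<Rightarrow> bool" where
  "halts_within I P s N s' \<longleftrightarrow> (\<exists>n\<le>N. exec I P s n s')"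

text \<open>An interpreter for loop-free programs. It lets the simplifier execute straight-line code, while
loops are treated by \<open>halts_within_While\<close>; on a loop the value \<open>None\<close>, like the cost 0 below, is a
dummy.\<close>

primrec run :: "shuttle_data \<Rightarrow> prog \<Rightarrow> state \<Rightarrow> state option" where
  "run I Skip s = Some s"
| "run I (Store e1 e2) s = Option.bind (Option.bind (eval_expr I (fst s) e1) address)
     (\<lambda>a. map_option (\<lambda>v. ((fst s)(a := v), snd s)) (eval_expr I (fst s) e2))"
| "run I (Emit e) s = map_option (\<lambda>v. (fst s, snd s @ [v])) (eval_expr I (fst s) e)"
| "run I (Seq P Q) s = Option.bind (run I P s) (run I Q)"
| "run I (Cond b P Q) s =
     Option.bind (eval_test I (fst s) b) (\<lambda>c. if c then run I P s else run I Q s)"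
| "run I (While b P) s = None"

primrec prog_cost :: "prog \<Rightarrow> nat" where
  "prog_cost Skip = 1"
| "prog_cost (Store e1 e2) = expr_cost e1 + expr_cost e2 + 1"
| "prog_cost (Emit e) = expr_cost e + 1"
| "prog_cost (Seq P Q) = prog_cost P + prog_cost Q + 1"
| "prog_cost (Cond b P Q) = test_cost b + prog_cost P + prog_cost Q + 1"
| "prog_cost (While b P) = 0"

lemma halts_within_mono: "halts_within I P s N s' \<Longrightarrow> N \<le> N' \<Longrightarrow> halts_within I P s N' s'"
  unfolding halts_within_def using le_trans by blast

lemma halts_within_Seq:
  "halts_within I P s n s' \<Longrightarrow> halts_within I Q s' n' s'' \<Longrightarrow> halts_within I (Seq P Q) s (n + n' + 1) s''"
  unfolding halts_within_def by (meson exec.Seq add_le_mono le_refl)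

lemma halts_within_Cond:
  assumes "eval_test I (fst s) b = Some c" "halts_within I (if c then P else Q) s n s'"
  shows "halts_within I (Cond b P Q) s (test_cost b + n + 1) s'"
proof -
  obtain k where k: "k \<le> n" "exec I (if c then P else Q) s k s'"
    using assms(2) unfolding halts_within_def by blast
  have "exec I (Cond b P Q) s (test_cost b + k + 1) s'"
    using assms(1) k(2) by (cases c) (simp_all only: if_True if_False exec.Cond_True exec.Cond_False)
  then show ?thesis
    unfolding halts_within_def using k(1) by (intro exI[of _ "test_cost b + k + 1"]) simp
qed

lemma halts_within_run: "run I P s = Some s' \<Longrightarrow> halts_within I P s (prog_cost P) s'"
proof (induction P arbitrary: s s')
  case Skip
  then show ?case using exec.Skip[of I s] by (auto simp: halts_within_def)
next
  case (Store e1 e2)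
  then show ?case
    by (cases s) (fastforce simp: halts_within_def bind_eq_Some_conv dest: exec.Store)
next
  case (Emit e)
  then show ?case by (cases s) (fastforce simp: halts_within_def dest: exec.Emit)
next
  case (Seq P Q)
  then obtain t where "run I P s = Some t" "run I Q t = Some s'"
    by (auto simp: bind_eq_Some_conv)
  from halts_within_Seq[OF Seq.IH(1)[OF this(1)] Seq.IH(2)[OF this(2)]] show ?case by simp
next
  case (Cond b P Q)
  then obtain c where c: "eval_test I (fst s) b = Some c"
      "(if c then run I P s else run I Q s) = Some s'"
    by (auto simp only: run.simps bind_eq_Some_conv)
  have "halts_within I (if c then P else Q) s (prog_cost P + prog_cost Q) s'"
    using c(2) halts_within_mono[OF Cond.IH(1)] halts_within_mono[OF Cond.IH(2)]
    by (cases c) simp_all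
  from halts_within_Cond[OF c(1) this] show ?case by (simp add: add.assoc)
next
  case (While b P)
  then show ?case by simp
qed

text \<open>The states \<open>st 0, \<dots>, st n\<close> at the loop head are given in advance, as every loop below runs through a
sequence of states known in closed form.\<close>

lemma halts_within_While:
  assumes "\<And>j. j < n \<Longrightarrow> eval_test I (fst (st j)) b = Some True"
    and "\<And>j. j < n \<Longrightarrow> halts_within I P (st j) c (st (Suc j))"
    and "eval_test I (fst (st n)) b = Some False"
  shows "halts_within I (While b P) (st 0) (n * (test_cost b + c + 1) + test_cost b + 1) (st n)"
  using assms
proof (induction n arbitrary: st)
  case 0
  then show ?case
    using exec.While_False[of I "st 0" b P]
    unfolding halts_within_def by (intro exI[of _ "test_cost b + 1"]) simp
next
  case (Suc n)
  have "halts_within I (While b P) (st (Suc 0)) (n * (test_cost b + c + 1) + test_cost b + 1) (st (Suc n))"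
    using Suc.prems by (intro Suc.IH[of "\<lambda>j. st (Suc j)"]) auto
  moreover have "halts_within I P (st 0) c (st (Suc 0))" using Suc.prems(2)[of 0] by simp
  ultimately obtain k k' where
    k: "k \<le> n * (test_cost b + c + 1) + test_cost b + 1"
       "exec I (While b P) (st (Suc 0)) k (st (Suc n))"
       "k' \<le> c" "exec I P (st 0) k' (st (Suc 0))"
    unfolding halts_within_def by blast
  have "exec I (While b P) (st 0) (test_cost b + k' + k + 1) (st (Suc n))"
    using Suc.prems(1)[of 0] k by (intro exec.While_True) auto
  then show ?case
    unfolding halts_within_def using k by (intro exI[of _ "test_cost b + k' + k + 1"]) auto
qed

text \<open>Memories with finitely many nonzero cells, represented by lists so that lookup and update at
numeral addresses are computed by simplification.\<close>

definition cells :: "real list \<Rightarrow> nat \<Rightarrow> real" where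
  "cells xs i = (if i < length xs then xs ! i else 0)"

lemma cells_lookup [simp]:
  "cells (x # xs) 0 = x"
  "cells (x # xs) (Suc 0) = cells xs 0"
  "cells (x # xs) (numeral k) = cells xs (pred_numeral k)"
  by (simp_all add: cells_def numeral_eq_Suc)

lemma cells_update [simp]:
  "(cells (x # xs))(0 := v) = cells (v # xs)"
  "0 < length xs \<Longrightarrow> (cells (x # xs))(Suc 0 := v) = cells (x # xs[0 := v])"
  "numeral k < Suc (length xs) \<Longrightarrow>
     (cells (x # xs))(numeral k := v) = cells (x # xs[pred_numeral k := v])"
  by (auto simp: cells_def fun_eq_iff nth_Cons' nth_list_update numeral_eq_Suc)

lemma list_update_numeral [simp]:
  "(x # xs)[numeral k := v] = x # xs[pred_numeral k := v]"
  by (simp add: numeral_eq_Suc)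

lemma address_simps [simp]:
  "address 0 = Some 0" "address 1 = Some 1" "address (numeral k) = Some (numeral k)"
  by (simp_all add: address_def)

section \<open>The programs\<close>

text \<open>The memory layout shared by both programs.\<close>

abbreviation "shuttles \<equiv> Cell (Num 0)"
abbreviation "demand_cell \<equiv> Cell (Num 1)"
abbreviation "step_cell \<equiv> Cell (Num 2)"
abbreviation "limit_cell \<equiv> Cell (Num 3)"
abbreviation "unsaturated_cell \<equiv> Cell (Num 4)"
abbreviation "rest_cell \<equiv> Cell (Num 5)"
abbreviation "full_cell \<equiv> Cell (Num 6)"
abbreviation "partial_cell \<equiv> Cell (Num 7)"
abbreviation "batch_cell \<equiv> Cell (Num 8)"
abbreviation "departure_cell \<equiv> Cell (Num 9)"
abbreviation "load_cell \<equiv> Cell (Num 10)"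
abbreviation "sum_cell \<equiv> Cell (Num 11)"
abbreviation "count_cell \<equiv> Cell (Num 12)"

primrec assign :: "expr \<Rightarrow> expr \<Rightarrow> prog" where
  "assign (Cell a) e = Store a e"

abbreviation increment :: "expr \<Rightarrow> expr \<Rightarrow> prog" where
  "increment c e \<equiv> assign c (Binary Add c e)"

definition init_prog :: prog where
  "init_prog =
     Seq (assign demand_cell (Unary Eval_D (Param Period)))
    (Seq (Cond (Less (Num 0) (Param Load_Rate))
            (assign step_cell (Binary Div (Param Return_Time) (Param Load_Rate))) Skip)
    (Seq (assign limit_cell (Num 1))
    (Seq (assign unsaturated_cell (Param Capacity))
    (Seq (assign rest_cell (Binary Div demand_cell shuttles))
         (assign partial_cell (Num 1))))))"

text \<open>The loop condition fails at once if \<open>\<nu> = 0\<close>.\<close>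

definition limit_loop :: prog where
  "limit_loop =
     While (Less (Binary Mult limit_cell (Param Return_Time))
                 (Binary Mult (Param Load_Rate) (Param Capacity)))
      (Seq (increment unsaturated_cell
              (Binary Sub (Param Capacity) (Binary Mult limit_cell step_cell)))
           (increment limit_cell (Num 1)))"

definition full_loop :: prog where
  "full_loop =
     While (Less unsaturated_cell rest_cell)
      (Seq (assign rest_cell (Binary Sub rest_cell (Param Capacity)))
           (increment full_cell (Num 1)))"

definition partial_loop :: prog where
  "partial_loop =
     While (Less (Binary Mult (Binary Mult (Param Return_Time) partial_cell)
                              (Binary Add partial_cell (Num 1)))
                 (Binary Mult (Binary Mult (Num 2) (Param Load_Rate)) rest_cell))
      (increment partial_cell (Num 1))"

definition setup_prog :: prog where
  "setup_prog = Seq (Seq init_prog limit_loop) (Seq full_loop partial_loop)"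

definition load_prog :: prog where
  "load_prog =
     Seq (Cond (Less batch_cell full_cell)
            (assign load_cell (Param Capacity))
            (assign load_cell
              (Binary Add (Binary Div rest_cell partial_cell)
                (Binary Mult step_cell
                  (Binary Sub (Binary Div (Binary Sub partial_cell (Num 1)) (Num 2))
                              (Binary Sub batch_cell full_cell))))))
         (increment departure_cell (Binary Mult (Param Load_Rate) load_cell))"

definition next_prog :: prog where
  "next_prog = Seq (increment departure_cell (Param Return_Time)) (increment batch_cell (Num 1))"

text \<open>A traversal of the batches. The argument processes one batch whose common load and departure time
have already been stored; computing the value and writing out the solution differ only in it.\<close>

definition batch_loop :: "prog \<Rightarrow> prog" where
  "batch_loop P =
     Seq setup_prog
       (While (Less batch_cell (Binary Add full_cell partial_cell))
         (Seq load_prog (Seq P next_prog)))"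

definition value_prog :: prog where
  "value_prog =
     Seq (batch_loop (increment sum_cell (Binary Mult load_cell departure_cell)))
         (Emit (Binary Div (Binary Mult shuttles sum_cell) demand_cell))"

definition solution_prog :: prog where
  "solution_prog =
     batch_loop
      (Seq (While (Less count_cell shuttles)
             (Seq (increment sum_cell load_cell)
             (Seq (Emit departure_cell)
             (Seq (Emit sum_cell)
                  (increment count_cell (Num 1))))))
           (assign count_cell (Num 0)))"

section \<open>Correctness and running time\<close>

context constant_demand begin

text \<open>The memory during the setup loops, as a function of the loop counters. The value of
\<open>unsaturated_cell\<close> is an initial segment of the sum that defines \<open>unsaturated_max\<close>. All time
bounds below are rounded up generously.\<close>

definition setup_cells :: "nat \<Rightarrow> nat \<Rightarrow> nat \<Rightarrow> nat \<Rightarrow> real list \<Rightarrow> nat \<Rightarrow> real" where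
  "setup_cells S m s k zs = cells ([real S, total_demand I, load_step I, real m,
     (\<Sum>a<m. capacity I - real a * load_step I),
     total_demand I / real S - real s * capacity I, real s, real k] @ zs)"

abbreviation "zeros \<equiv> [0, 0, 0, 0, 0]"

lemma init_within:
  assumes "S \<ge> 1"
  shows "halts_within I init_prog ((\<lambda>_. 0)(0 := real S), []) 100 (setup_cells S 1 0 1 zeros, [])"
proof -
  have start: "(\<lambda>_. 0)(0 := real S) = cells [real S, 0, 0, 0, 0, 0, 0, 0, 0, 0, 0, 0, 0]"
    by (auto simp: cells_def fun_eq_iff nth_Cons')
  have "run I init_prog ((\<lambda>_. 0)(0 := real S), []) = Some (setup_cells S 1 0 1 zeros, [])"
    using assms data_bounds
    by (auto simp: start init_prog_def setup_cells_def total_demand_def load_step_def)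
  from halts_within_run[OF this] show ?thesis
    by (rule halts_within_mono) (simp add: init_prog_def)
qed

lemma limit_within:
  "halts_within I limit_loop (setup_cells S 1 s k zs, out) (100 * partial_limit I)
     (setup_cells S (partial_limit I) s k zs, out)"
proof -
  let ?st = "\<lambda>j. (setup_cells S (Suc j) s k zs, out)"
  have Suc: "Suc (partial_limit I - 1) = partial_limit I" using partial_limit_bounds(1) by simp
  have "halts_within I limit_loop (?st 0) ((partial_limit I - 1) * 50 + 50) (?st (partial_limit I - 1))"
    unfolding limit_loop_def
  proof (rule halts_within_mono[OF halts_within_While[where c = 20]])
    fix j assume j: "j < partial_limit I - 1"
    then have "real (Suc j) * return_time I < load_rate I * capacity I"
      by (intro below_partial_limit) auto
    then show "eval_test I (fst (?st j)) (Less (Binary Mult limit_cell (Param Return_Time))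
        (Binary Mult (Param Load_Rate) (Param Capacity))) = Some True"
      by (simp add: setup_cells_def)
    show "halts_within I (Seq (increment unsaturated_cell
              (Binary Sub (Param Capacity) (Binary Mult limit_cell step_cell)))
           (increment limit_cell (Num 1))) (?st j) 20 (?st (Suc j))"
      by (rule halts_within_mono[OF halts_within_run]) (simp_all add: setup_cells_def algebra_simps)
  next
    show "eval_test I (fst (?st (partial_limit I - 1)))
       (Less (Binary Mult limit_cell (Param Return_Time))
        (Binary Mult (Param Load_Rate) (Param Capacity))) = Some False"
      unfolding Suc using partial_limit_bounds(2) by (simp add: setup_cells_def)
  qed simp
  from this[unfolded Suc, folded One_nat_def] show ?thesis
    by (rule halts_within_mono) (use partial_limit_bounds(1) in simp)
qed

lemma full_within:
  fixes S :: nat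
  defines "n \<equiv> full_batches I (total_demand I / real S)"
  shows "halts_within I full_loop (setup_cells S (partial_limit I) 0 k zs, out) (100 * n + 100)
     (setup_cells S (partial_limit I) n k zs, out)"
proof -
  let ?st = "\<lambda>j. (setup_cells S (partial_limit I) j k zs, out)"
  show ?thesis
    unfolding full_loop_def
  proof (rule halts_within_mono[OF halts_within_While[where c = 20 and st = ?st]])
    fix j assume j: "j < n"
    then show "eval_test I (fst (?st j)) (Less unsaturated_cell rest_cell) = Some True"
      using before_full_batches[of j "total_demand I / real S"]
      by (simp add: setup_cells_def n_def unsaturated_max_def)
    show "halts_within I (Seq (assign rest_cell (Binary Sub rest_cell (Param Capacity)))
           (increment full_cell (Num 1))) (?st j) 20 (?st (Suc j))"
      by (rule halts_within_mono[OF halts_within_run]) (simp_all add: setup_cells_def algebra_simps)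
  next
    show "eval_test I (fst (?st n)) (Less unsaturated_cell rest_cell) = Some False"
      using remainder_le[of "total_demand I / real S"]
      by (simp add: setup_cells_def n_def unsaturated_max_def remainder_def)
  qed simp
qed

lemma partial_within:
  fixes S :: nat
  defines "w \<equiv> total_demand I / real S"
  defines "s \<equiv> full_batches I w" and "k \<equiv> partial_batches I w"
  shows "halts_within I partial_loop (setup_cells S m s 1 zs, out) (100 * k) (setup_cells S m s k zs, out)"
proof -
  let ?st = "\<lambda>j. (setup_cells S m s (Suc j) zs, out)"
  let ?b = "Less (Binary Mult (Binary Mult (Param Return_Time) partial_cell)
                              (Binary Add partial_cell (Num 1)))
                 (Binary Mult (Binary Mult (Num 2) (Param Load_Rate)) rest_cell)"
  have rest: "total_demand I / real S - real s * capacity I = remainder I w"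
    by (simp add: remainder_def s_def w_def)
  have Suc: "Suc (k - 1) = k" using partial_batches_bounds(1)[of w] by (simp add: k_def)
  have "halts_within I partial_loop (?st 0) ((k - 1) * 50 + 50) (?st (k - 1))"
    unfolding partial_loop_def
  proof (rule halts_within_mono[OF halts_within_While[where c = 20]])
    fix j assume j: "j < k - 1"
    then show "eval_test I (fst (?st j)) ?b = Some True"
      using before_partial_batches[of "Suc j" w] by (simp add: setup_cells_def rest k_def)
    show "halts_within I (increment partial_cell (Num 1)) (?st j) 20 (?st (Suc j))"
      by (rule halts_within_mono[OF halts_within_run]) (simp_all add: setup_cells_def algebra_simps)
  next
    show "eval_test I (fst (?st (k - 1))) ?b = Some False"
      unfolding Suc using partial_batches_bounds(2)[of w] by (simp add: setup_cells_def rest k_def)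
  qed simp
  from this[unfolded Suc, folded One_nat_def] show ?thesis
    by (rule halts_within_mono) (use Suc in simp)
qed

lemma setup_within:
  fixes S :: nat
  assumes "S \<ge> 1"
  defines "w \<equiv> total_demand I / real S"
  shows "halts_within I setup_prog ((\<lambda>_. 0)(0 := real S), []) (300 + 100 * (partial_limit I + batches I w))
     (setup_cells S (partial_limit I) (full_batches I w) (partial_batches I w) zeros, [])"
  unfolding setup_prog_def
  by (rule halts_within_mono[OF halts_within_Seq[OF halts_within_Seq[OF init_within[OF assms(1)] limit_within]
        halts_within_Seq[OF full_within partial_within], folded w_def]])
     (simp add: batches_def)

definition batch_cells :: "nat \<Rightarrow> nat \<Rightarrow> real \<Rightarrow> real \<Rightarrow> real \<Rightarrow> real \<Rightarrow> nat \<Rightarrow> real" where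
  "batch_cells S a d x y i = setup_cells S (partial_limit I) (full_batches I (total_demand I / real S))
     (partial_batches I (total_demand I / real S)) [real a, d, x, y, i]"

text \<open>\<open>Y\<close> is what the processing of a batch accumulates in \<open>sum_cell\<close>, and \<open>out\<close> is the output written so
far. The cell for the trip counter must be 0 again after each batch. The three cells of the final
memory in the conclusion are those from which the optimal value is computed.\<close>

lemma batch_loop_within:
  fixes S :: nat
  defines "w \<equiv> total_demand I / real S"
  defines "X \<equiv> batch_load I w"
  defines "D \<equiv> shuttle_departure I X"
  assumes S: "S \<ge> 1"
    and body: "\<And>a. a < batches I w \<Longrightarrow>
      halts_within I P (batch_cells S a (D a) (X a) (Y a) 0, out a) c
        (batch_cells S a (D a) (X a) (Y (Suc a)) 0, out (Suc a))"
    and init: "Y 0 = 0" "out 0 = []"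
  shows "\<exists>m. halts_within I (batch_loop P) ((\<lambda>_. 0)(0 := real S), [])
      (400 + 100 * partial_limit I + batches I w * (c + 200))
      (m, out (batches I w)) \<and> m 0 = real S \<and> m 1 = total_demand I \<and> m 11 = Y (batches I w)"
proof -
  let ?N = "batches I w"
  \<comment> \<open>The load cell still holds the previous load when a batch begins.\<close>
  define st where "st a = (batch_cells S a (real a * return_time I + load_rate I * (\<Sum>b<a. X b))
      (case a of 0 \<Rightarrow> 0 | Suc b \<Rightarrow> X b) (Y a) 0, out a)" for a
  let ?b = "Less batch_cell (Binary Add full_cell partial_cell)"
  have st0: "st 0 = (setup_cells S (partial_limit I) (full_batches I w) (partial_batches I w) zeros, [])"
    by (simp add: st_def batch_cells_def w_def init)
  have D: "D a = real a * return_time I + load_rate I * (\<Sum>b<a. X b) + load_rate I * X a" for a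
    by (simp add: D_def shuttle_departure_def algebra_simps lessThan_Suc_atMost[symmetric])
  have "halts_within I (While ?b (Seq load_prog (Seq P next_prog))) (st 0) (?N * (c + 89) + 10) (st ?N)"
  proof (rule halts_within_mono[OF halts_within_While[where c = "c + 80"]])
    fix a assume a: "a < ?N"
    then show "eval_test I (fst (st a)) ?b = Some True"
      by (simp add: st_def batch_cells_def setup_cells_def batches_def flip: w_def)
    let ?s1 = "(batch_cells S a (D a) (X a) (Y a) 0, out a)"
    let ?s2 = "(batch_cells S a (D a) (X a) (Y (Suc a)) 0, out (Suc a))"
    have X: "X a = (if a < full_batches I w then capacity I
        else remainder I w / real (partial_batches I w)
          + load_step I * ((real (partial_batches I w) - 1) / 2
            - (real a - real (full_batches I w))))"
      using a by (simp add: X_def batch_load_def partial_load_def of_nat_diff)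
    have "run I load_prog (st a) = Some ?s1"
      using partial_batches_bounds(1)[of w]
      by (simp add: st_def batch_cells_def setup_cells_def load_prog_def X D remainder_def
          flip: w_def)
    then have load: "halts_within I load_prog (st a) (prog_cost load_prog) ?s1" by (rule halts_within_run)
    have "run I next_prog ?s2 = Some (st (Suc a))"
      by (simp add: st_def batch_cells_def setup_cells_def next_prog_def D algebra_simps)
    then have "halts_within I next_prog ?s2 (prog_cost next_prog) (st (Suc a))" by (rule halts_within_run)
    from halts_within_Seq[OF load halts_within_Seq[OF body[OF a] this]]
    show "halts_within I (Seq load_prog (Seq P next_prog)) (st a) (c + 80) (st (Suc a))"
      by (rule halts_within_mono) (simp add: load_prog_def next_prog_def)
  next
    show "eval_test I (fst (st ?N)) ?b = Some False"
      by (simp add: st_def batch_cells_def setup_cells_def batches_def flip: w_def)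
  qed (simp add: add.commute)
  then have "halts_within I (batch_loop P) ((\<lambda>_. 0)(0 := real S), [])
      (400 + 100 * partial_limit I + ?N * (c + 200)) (st ?N)"
    unfolding batch_loop_def
    by (intro halts_within_mono[OF halts_within_Seq[OF setup_within[OF S, folded w_def, folded st0]]])
       (auto simp: algebra_simps)
  then show ?thesis
    by (intro exI[of _ "fst (st ?N)"]) (auto simp: st_def batch_cells_def setup_cells_def)
qed

lemma value_within:
  fixes S :: nat
  assumes S: "S \<ge> 1"
  defines "w \<equiv> total_demand I / real S"
  shows "outputs_within I value_prog S [real S * shuttle_cost I w / total_demand I]
    (500 + 100 * partial_limit I + 300 * batches I w)"
proof -
  let ?X = "batch_load I w"
  let ?D = "shuttle_departure I ?X"
  let ?body = "increment sum_cell (Binary Mult load_cell departure_cell)"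
  let ?Y = "\<lambda>n. \<Sum>a<n. ?X a * ?D a"
  have "halts_within I ?body (batch_cells S a (?D a) (?X a) (?Y a) 0, []) 20
        (batch_cells S a (?D a) (?X a) (?Y (Suc a)) 0, [])" for a
    by (rule halts_within_mono[OF halts_within_run]) (simp_all add: batch_cells_def setup_cells_def)
  then obtain m where m: "halts_within I (batch_loop ?body) ((\<lambda>_. 0)(0 := real S), [])
      (400 + 100 * partial_limit I + batches I w * 220) (m, [])"
      "m 0 = real S" "m 1 = total_demand I" "m 11 = ?Y (batches I w)"
    using batch_loop_within[OF S, of ?body ?Y "\<lambda>_. []" 20, folded w_def] by auto
  let ?e = "Binary Div (Binary Mult shuttles sum_cell) demand_cell"
  have "halts_within I (Emit ?e) (m, []) (prog_cost (Emit ?e))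
      (m, [real S * shuttle_cost I w / total_demand I])"
    using data_bounds m(2-) by (intro halts_within_run) (simp add: shuttle_cost_def)
  from halts_within_mono[OF halts_within_Seq[OF m(1) this], of "500 + 100 * partial_limit I + 300 * batches I w"]
  show ?thesis
    by (auto simp: outputs_within_def value_prog_def halts_within_def)
qed

lemma schedule_output_Suc_trip:
  fixes S :: nat
  assumes "i < S"
  shows "schedule_output I S x (a * S + Suc i) = schedule_output I S x (a * S + i)
    @ [shuttle_departure I x a, cumulative_load S x (a * S + i) + x a]"
  using assms by (simp add: schedule_output_def cumulative_load_def)

text \<open>Only here the time depends on \<open>S\<close>: each of the \<open>S\<close> trips of a batch is written out separately.\<close>

lemma solution_within:
  fixes S :: nat
  assumes S: "S \<ge> 1"
  defines "w \<equiv> total_demand I / real S"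
  shows "outputs_within I solution_prog S (schedule_output I S (batch_load I w) (batches I w * S))
    (400 + 100 * partial_limit I + batches I w * (50 * S + 300))"
proof -
  let ?X = "batch_load I w"
  let ?D = "shuttle_departure I ?X"
  let ?b = "Less count_cell shuttles"
  let ?trip = "Seq (increment sum_cell load_cell) (Seq (Emit departure_cell)
             (Seq (Emit sum_cell) (increment count_cell (Num 1))))"
  let ?body = "Seq (While ?b ?trip) (assign count_cell (Num 0))"
  let ?Y = "\<lambda>a. cumulative_load S ?X (a * S)" and ?out = "\<lambda>a. schedule_output I S ?X (a * S)"
  have body: "halts_within I ?body (batch_cells S a (?D a) (?X a) (?Y a) 0, ?out a) (50 * S + 100)
        (batch_cells S a (?D a) (?X a) (?Y (Suc a)) 0, ?out (Suc a))" for a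
  proof -
    define st where "st i = (batch_cells S a (?D a) (?X a) (cumulative_load S ?X (a * S + i)) (real i),
      schedule_output I S ?X (a * S + i))" for i
    have "halts_within I (While ?b ?trip) (st 0) (S * 50 + 50) (st S)"
    proof (rule halts_within_mono[OF halts_within_While[where c = 30]])
      fix i assume i: "i < S"
      then show "eval_test I (fst (st i)) ?b = Some True"
        by (simp add: st_def batch_cells_def setup_cells_def)
      have "cumulative_load S ?X (a * S + Suc i) = cumulative_load S ?X (a * S + i) + ?X a"
        using i by (simp add: cumulative_load_def)
      then have "run I ?trip (st i) = Some (st (Suc i))"
        using schedule_output_Suc_trip[OF i, of ?X a]
        by (simp add: st_def batch_cells_def setup_cells_def add.commute[of 1])
      then show "halts_within I ?trip (st i) 30 (st (Suc i))"
        by (rule halts_within_mono[OF halts_within_run]) simp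
    next
      show "eval_test I (fst (st S)) ?b = Some False"
        by (simp add: st_def batch_cells_def setup_cells_def)
    qed simp
    moreover have "halts_within I (assign count_cell (Num 0)) (st S) 10
        (batch_cells S a (?D a) (?X a) (?Y (Suc a)) 0, ?out (Suc a))"
      by (rule halts_within_mono[OF halts_within_run])
         (simp_all add: st_def batch_cells_def setup_cells_def add.commute)
    ultimately have "halts_within I ?body (st 0) (50 * S + 100)
        (batch_cells S a (?D a) (?X a) (?Y (Suc a)) 0, ?out (Suc a))"
      by (intro halts_within_mono[OF halts_within_Seq]) auto
    then show ?thesis by (simp add: st_def)
  qed
  have start: "?Y 0 = 0" "?out 0 = []" by (simp_all add: cumulative_load_def schedule_output_def)
  have cost: "50 * S + 300 = 50 * S + 100 + 200" by simp
  have "\<exists>m. halts_within I (batch_loop ?body) ((\<lambda>_. 0)(0 := real S), [])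
      (400 + 100 * partial_limit I + batches I w * (50 * S + 300)) (m, ?out (batches I w))"
    using batch_loop_within[OF S, folded w_def, of ?body ?Y ?out "50 * S + 100",
        OF body start]
    unfolding cost by blast
  then show ?thesis
    unfolding outputs_within_def solution_prog_def halts_within_def by blast
qed

text \<open>The load \<open>D(T) / S\<close> per shuttle decreases with \<open>S\<close>, so a number of batches that suffices for a single
shuttle suffices for any fleet. This is why the number of rounds of all loops over batches is a
constant of the data.\<close>

lemma batches_bounded: "\<exists>B. \<forall>S\<ge>1. batches I (total_demand I / real S) \<le> B"
proof -
  let ?W = "total_demand I"
  obtain n :: nat where n: "?W < real n * capacity I"
    using reals_Archimedean3[OF data_bounds(1)] by blast
  obtain k :: nat where k: "2 * load_rate I * ?W < real k * return_time I"
    using reals_Archimedean3[OF return_pos] by blast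
  have k': "2 * load_rate I * ?W \<le> real (Suc k) * return_time I"
    using k return_pos by (simp add: algebra_simps)
  have "batches I (?W / real S) \<le> n + Suc k" if "S \<ge> 1" for S :: nat
  proof -
    have w: "?W / real S \<le> ?W"
      using that data_bounds by (simp add: divide_le_eq mult_le_cancel_left1)
    show ?thesis
      unfolding batches_def full_batches_def partial_batches_def
      using full_batches_exists[OF w, of n] partial_batches_exists[OF w _ k'] n
      by (intro add_mono Least_le) auto
  qed
  then show ?thesis by blast
qed

lemma value_prog_constant_time: "\<exists>K. \<forall>S\<ge>1. computes_optimal_value_within value_prog I S K"
proof -
  obtain B where B: "\<And>S. S \<ge> 1 \<Longrightarrow> batches I (total_demand I / real S) \<le> B"
    using batches_bounded by blast
  let ?K = "500 + 100 * partial_limit I + 300 * B"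
  have "computes_optimal_value_within value_prog I S ?K" if S: "S \<ge> 1" for S
    unfolding computes_optimal_value_within_def optimum(2)[OF S]
    using value_within[OF S] B[OF S] unfolding outputs_within_def by fastforce
  then show ?thesis by blast
qed

lemma solution_prog_linear_time:
  "\<exists>K. \<forall>S\<ge>1. computes_optimal_solution_within solution_prog I S (K * S)"
proof -
  obtain B where B: "\<And>S. S \<ge> 1 \<Longrightarrow> batches I (total_demand I / real S) \<le> B"
    using batches_bounded by blast
  let ?K = "400 + 100 * partial_limit I + 350 * B"
  have "computes_optimal_solution_within solution_prog I S (?K * S)" if S: "S \<ge> 1" for S
  proof -
    let ?w = "total_demand I / real S"
    let ?out = "schedule_output I S (batch_load I ?w) (batches I ?w * S)"
    have "400 + 100 * partial_limit I + batches I ?w * (50 * S + 300)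
        \<le> (400 + 100 * partial_limit I) * S + B * (350 * S)"
      using B[OF S] S by (intro add_mono mult_mono) auto
    also have "\<dots> = ?K * S" by (simp add: algebra_simps)
    finally have "outputs_within I solution_prog S ?out (?K * S)"
      using solution_within[OF S] le_trans unfolding outputs_within_def by blast
    moreover have "?out \<noteq> []" "even (length ?out)"
      using batches_pos[of ?w] S by (auto simp: schedule_output_def simp flip: length_0_conv)
    ultimately show ?thesis
      unfolding computes_optimal_solution_within_def using optimum(1)[OF S] by blast
  qed
  then show ?thesis by blast
qed

end

lemma constant_demandI:
  assumes "valid_data I \<and> return_time I > 0 \<and>
    (\<forall>t\<in>{0..period I}. demand I t = demand I (period I))"
  shows "constant_demand I"
  using assms by unfold_locales (unfold total_demand_def, blast+)

theorem proposition2: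
  shows "(\<exists>P. \<forall>I. valid_data I \<and> return_time I > 0 \<and>
              (\<forall>t\<in>{0..period I}. demand I t = demand I (period I)) \<longrightarrow>
            (\<exists>K. \<forall>S\<ge>1. computes_optimal_value_within P I S K)) \<and>
         (\<exists>P. \<forall>I. valid_data I \<and> return_time I > 0 \<and>
              (\<forall>t\<in>{0..period I}. demand I t = demand I (period I)) \<longrightarrow>
            (\<exists>K. \<forall>S\<ge>1. computes_optimal_solution_within P I S (K * S)))"
proof (rule conjI)
  show "\<exists>P. \<forall>I. valid_data I \<and> return_time I > 0 \<and>
      (\<forall>t\<in>{0..period I}. demand I t = demand I (period I)) \<longrightarrow>
      (\<exists>K. \<forall>S\<ge>1. computes_optimal_value_within P I S K)"
    by (rule exI[of _ value_prog], intro allI impI,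
        rule constant_demand.value_prog_constant_time, rule constant_demandI)
  show "\<exists>P. \<forall>I. valid_data I \<and> return_time I > 0 \<and>
      (\<forall>t\<in>{0..period I}. demand I t = demand I (period I)) \<longrightarrow>
      (\<exists>K. \<forall>S\<ge>1. computes_optimal_solution_within P I S (K * S))"
    by (rule exI[of _ solution_prog], intro allI impI,
        rule constant_demand.solution_prog_linear_time, rule constant_demandI)
qed

end
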